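(* There exists a constant $C>0$ such that the following holds. Let $T\in(0,1]$, $h_0,h_1\in L^2((0,T);\mathbb{C})$, $f\in L^1((0,T);L^2((0,1);\mathbb{C}))$ and $\phi\in C^0([0,T];H^2((0,1);\mathbb{C}))\cap C^1([0,T];L^2((0,1);\mathbb{C}))$. Assume that $\phi$ is a strong solution to $$i\partial_t\phi=-\partial_x^2\phi+f,\qquad\partial_x\phi(\cdot,0)=h_0,\qquad\partial_x\phi(\cdot,1)=h_1,$$ with initial data $\phi(0)=0$. Then $$\|\phi\|_{L^\infty((0,T);L^2(0,1))}\leq C\left(\|h_0\|_{L^2(0,T)}+\|h_1\|_{L^2(0,T)}+\|f\|_{L^1((0,T);L^2(0,1))}\right).$$
   Context: Strong solution means that the evolution equation holds as an equality in $C^0([0,T];L^2(0,1))$ and that the boundary conditions (traces of $\partial_x\phi$ at $x=0$ and $x=1$) hold pointwise in time. The constant $C$ is independent of $T,h_0,h_1,f,\phi$. *)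

theory Defs
  imports "HOL-Analysis.Analysis" "HOL-Probability.Essential_Supremum"
begin

text \<open>
  Elements of Lebesgue and Sobolev spaces are represented by functions. Every space and norm below is
  insensitive to changing a function on a null set, so equality of classes is equality almost
  everywhere. A time-dependent function \<open>u\<close> with values in a space of functions of \<open>x\<close> has the
  type \<open>real \<Rightarrow> real \<Rightarrow> complex\<close>, with time as its first argument. No joint measurability in
  \<open>(t, x)\<close> is imposed.
\<close>

definition L2_space :: "'a measure \<Rightarrow> ('a \<Rightarrow> complex) set" where
  "L2_space M = {g. g \<in> borel_measurable M \<and> integrable M (\<lambda>x. (cmod (g x))\<^sup>2)}"

definition L2_norm :: "'a measure \<Rightarrow> ('a \<Rightarrow> complex) \<Rightarrow> real" where
  "L2_norm M g = sqrt (\<integral>x. (cmod (g x))\<^sup>2 \<partial>M)"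

abbreviation leb01 :: "real measure" where
  "leb01 \<equiv> lebesgue_on {0<..<1}"


subsection \<open>The Sobolev space \<open>H\<^sup>2(0,1)\<close>\<close>

definition test_function :: "(real \<Rightarrow> real) \<Rightarrow> bool" where
  "test_function \<psi> \<longleftrightarrow>
     (\<forall>k x. (deriv ^^ k) \<psi> field_differentiable (at x)) \<and>
     compact (closure {x. \<psi> x \<noteq> 0}) \<and> closure {x. \<psi> x \<noteq> 0} \<subseteq> {0<..<1}"

definition is_weak_deriv :: "(real \<Rightarrow> complex) \<Rightarrow> (real \<Rightarrow> complex) \<Rightarrow> bool" where
  "is_weak_deriv g g' \<longleftrightarrow>
     (\<forall>\<psi>. test_function \<psi> \<longrightarrow>
        (\<integral>x. deriv \<psi> x *\<^sub>R g x \<partial>leb01) = - (\<integral>x. \<psi> x *\<^sub>R g' x \<partial>leb01))"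

text \<open>
  The weak derivative in \<open>L\<^sup>2(0,1)\<close>. If one exists it is unique up to null sets, and \<open>SOME\<close>
  selects a representative; otherwise the value is unspecified.
\<close>

definition weak_deriv :: "(real \<Rightarrow> complex) \<Rightarrow> real \<Rightarrow> complex" where
  "weak_deriv g = (SOME g'. g' \<in> L2_space leb01 \<and> is_weak_deriv g g')"

definition H1_space :: "(real \<Rightarrow> complex) set" where
  "H1_space = {g \<in> L2_space leb01. \<exists>g' \<in> L2_space leb01. is_weak_deriv g g'}"

definition H2_space :: "(real \<Rightarrow> complex) set" where
  "H2_space = {g \<in> H1_space. weak_deriv g \<in> H1_space}"

definition H2_norm :: "(real \<Rightarrow> complex) \<Rightarrow> real" where
  "H2_norm g = sqrt ((L2_norm leb01 g)\<^sup>2 + (L2_norm leb01 (weak_deriv g))\<^sup>2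
                     + (L2_norm leb01 (weak_deriv (weak_deriv g)))\<^sup>2)"

text \<open>
  The trace at a boundary point \<open>a\<close> is the value at \<open>a\<close> of the representative that is continuous
  on the closed interval. Such a representative exists for every element of \<open>H\<^sup>1(0,1)\<close> and is
  unique.
\<close>

definition has_trace :: "(real \<Rightarrow> complex) \<Rightarrow> real \<Rightarrow> complex \<Rightarrow> bool" where
  "has_trace g a c \<longleftrightarrow>
     (\<exists>G. continuous_on {0..1} G \<and> (AE x in leb01. G x = g x) \<and> G a = c)"


subsection \<open>Spaces of vector-valued functions of time\<close>

definition C0_space ::
  "(real \<Rightarrow> complex) set \<Rightarrow> ((real \<Rightarrow> complex) \<Rightarrow> real) \<Rightarrow> real \<Rightarrow> (real \<Rightarrow> real \<Rightarrow> complex) set" where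
  "C0_space X N T =
     {u. (\<forall>t\<in>{0..T}. u t \<in> X) \<and>
         (\<forall>s\<in>{0..T}. ((\<lambda>t. N (\<lambda>x. u t x - u s x)) \<longlongrightarrow> 0) (at s within {0..T}))}"

abbreviation C0_L2 :: "real \<Rightarrow> (real \<Rightarrow> real \<Rightarrow> complex) set" where
  "C0_L2 \<equiv> C0_space (L2_space leb01) (L2_norm leb01)"

abbreviation C0_H2 :: "real \<Rightarrow> (real \<Rightarrow> real \<Rightarrow> complex) set" where
  "C0_H2 \<equiv> C0_space H2_space H2_norm"

text \<open>Differentiability with respect to the norm of \<open>L\<^sup>2(0,1)\<close>, one-sided at \<open>0\<close> and \<open>T\<close>.\<close>

definition has_L2_time_deriv ::
  "real \<Rightarrow> (real \<Rightarrow> real \<Rightarrow> complex) \<Rightarrow> (real \<Rightarrow> real \<Rightarrow> complex) \<Rightarrow> bool" where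
  "has_L2_time_deriv T u u' \<longleftrightarrow>
     (\<forall>t\<in>{0..T}. u' t \<in> L2_space leb01 \<and>
        ((\<lambda>s. L2_norm leb01 (\<lambda>x. (u s x - u t x) /\<^sub>R (s - t) - u' t x)) \<longlongrightarrow> 0)
          (at t within {0..T}))"

definition C1_L2 :: "real \<Rightarrow> (real \<Rightarrow> real \<Rightarrow> complex) set" where
  "C1_L2 T = {u \<in> C0_L2 T. \<exists>u' \<in> C0_L2 T. has_L2_time_deriv T u u'}"

text \<open>
  The Bochner space \<open>L\<^sup>1((0,T);L\<^sup>2(0,1))\<close>: strongly measurable functions, that is almost everywhere
  limits of simple functions, whose norm is integrable.
\<close>

definition L1_L2 :: "real \<Rightarrow> (real \<Rightarrow> real \<Rightarrow> complex) set" where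
  "L1_L2 T =
     {f. (\<forall>t\<in>{0<..<T}. f t \<in> L2_space leb01) \<and>
         (\<exists>s. (\<forall>n. simple_function (lebesgue_on {0<..<T}) (s n) \<and>
                   (\<forall>t\<in>{0<..<T}. s n t \<in> L2_space leb01)) \<and>
              (AE t in lebesgue_on {0<..<T}.
                 (\<lambda>n. L2_norm leb01 (\<lambda>x. s n t x - f t x)) \<longlonglongrightarrow> 0)) \<and>
         integrable (lebesgue_on {0<..<T}) (\<lambda>t. L2_norm leb01 (f t))}"

definition L1_L2_norm :: "real \<Rightarrow> (real \<Rightarrow> real \<Rightarrow> complex) \<Rightarrow> real" where
  "L1_L2_norm T f = (\<integral>t. L2_norm leb01 (f t) \<partial>lebesgue_on {0<..<T})"

definition Linf_L2_norm :: "real \<Rightarrow> (real \<Rightarrow> real \<Rightarrow> complex) \<Rightarrow> ereal" where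
  "Linf_L2_norm T u = esssup (lebesgue_on {0<..<T}) (\<lambda>t. ereal (L2_norm leb01 (u t)))"


subsection \<open>Strong solutions\<close>

text \<open>
  The equation holds in \<open>L\<^sup>2(0,1)\<close>, hence almost everywhere in \<open>x\<close>, at every time in \<open>[0,T]\<close>, and
  so do the boundary conditions. Thus \<open>f\<close>, \<open>h0\<close> and \<open>h1\<close> stand for those representatives of their
  classes for which this is the case; by the regularity of \<open>\<phi>\<close> they are the continuous ones.
\<close>

definition strong_solution ::
  "real \<Rightarrow> (real \<Rightarrow> complex) \<Rightarrow> (real \<Rightarrow> complex) \<Rightarrow> (real \<Rightarrow> real \<Rightarrow> complex) \<Rightarrow>
   (real \<Rightarrow> real \<Rightarrow> complex) \<Rightarrow> bool" where
  "strong_solution T h0 h1 f \<phi> \<longleftrightarrow>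
     (\<exists>\<phi>'. has_L2_time_deriv T \<phi> \<phi>' \<and>
        (\<forall>t\<in>{0..T}. AE x in leb01.
           \<i> * \<phi>' t x = - weak_deriv (weak_deriv (\<phi> t)) x + f t x)) \<and>
     (\<forall>t\<in>{0..T}. has_trace (weak_deriv (\<phi> t)) 0 (h0 t)) \<and>
     (\<forall>t\<in>{0..T}. has_trace (weak_deriv (\<phi> t)) 1 (h1 t))"

end

theory Submission imports Defs begin

text \<open>
  For a finite cosine sum \<open>p = \<Sum> a\<^sub>n cos (n \<pi> x)\<close> let
  \<open>\<Psi> s = \<Sum> a\<^sub>n exp (\<i> (n \<pi>)\<^sup>2 (s - t)) cos (n \<pi> x)\<close>, which solves the adjoint
  Schroedinger equation with homogeneous Neumann conditions and equals \<open>p\<close> at time \<open>t\<close>. The pairing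
  \<open>\<integral> \<phi> s \<Psi> s dx\<close> vanishes at \<open>s = 0\<close>, and integration by parts in \<open>x\<close> shows that its derivative is
  \<open>\<i> (h1 s (\<Psi> s 1) - h0 s (\<Psi> s 0) - \<integral> f s \<Psi> s dx)\<close>. The norm of \<open>\<Psi> s\<close> in \<open>L\<^sup>2(0,1)\<close> is that
  of \<open>p\<close>, and the boundary values of \<open>\<Psi>\<close> are exponential sums in time with frequencies in
  \<open>\<pi>\<^sup>2 \<nat>\<close>, so orthogonality over two periods bounds them in \<open>L\<^sup>2(0,T)\<close> by the norm of \<open>p\<close>: this is
  the hidden regularity that makes data in \<open>L\<^sup>2\<close> admissible. Hence \<open>\<integral> \<phi> t p dx\<close> is bounded by the
  right-hand side times the norm of \<open>p\<close>, and cosine sums are dense.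
\<close>

subsection \<open>Square-integrable functions\<close>

text \<open>Testing the equation with the conjugate of \<open>\<phi>\<close> would leave products of
  \<open>h0\<close> and \<open>h1\<close> with the boundary values of \<open>\<phi>\<close>, which
  the norm of \<open>\<phi>\<close> in L2 does not control. A test function with explicit traces
  avoids this. The obstacle is then the meaning of the boundary terms: weak derivatives are tested
  only with functions supported away from the endpoints, cosines do not vanish there, and a trace is
  the value of some continuous representative. Cutoffs bridge this gap. Only
  \<open>weak_deriv (\<phi> s)\<close> has prescribed traces; the second integration by parts meets
  a sine, so boundary values of \<open>\<phi>\<close> never appear. The pairing is differentiated
  mode by mode, as a finite sum of scalar functions of time. The constant is 2: a cosine has squared
  norm at least 1/2 and 4/\<pi> \<le> 2, so passing from the norm of \<open>p\<close> to that of a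
  trace of \<Psi> costs at most sqrt (2 * 2). It does not depend on \<open>T\<close> because the
  time integral is enlarged to the fixed interval (0, 4/\<pi>).\<close>

lemma L2_space_measurable [measurable_dest]: "f \<in> L2_space M \<Longrightarrow> f \<in> borel_measurable M"
  by (simp add: L2_space_def)

lemma L2_space_integrable_square: "f \<in> L2_space M \<Longrightarrow> integrable M (\<lambda>x. (cmod (f x))\<^sup>2)"
  by (simp add: L2_space_def)

lemma L2_norm_nonneg [simp]: "0 \<le> L2_norm M f"
  by (simp add: L2_norm_def)

lemma L2_norm_square: "(L2_norm M f)\<^sup>2 = (\<integral>x. (cmod (f x))\<^sup>2 \<partial>M)"
  by (simp add: L2_norm_def)

lemma L2_space_mult_integrable:
  assumes "f \<in> L2_space M" "g \<in> L2_space M"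
  shows "integrable M (\<lambda>x. f x * g x)"
proof (rule Bochner_Integration.integrable_bound)
  show "integrable M (\<lambda>x. (cmod (f x))\<^sup>2 + (cmod (g x))\<^sup>2)"
    using assms by (auto simp: L2_space_def)
  show "(\<lambda>x. f x * g x) \<in> borel_measurable M"
    using assms by (auto simp: L2_space_def)
  have "norm (f x * g x) \<le> norm ((cmod (f x))\<^sup>2 + (cmod (g x))\<^sup>2)" for x
  proof -
    have "cmod (f x) * cmod (g x) \<le> (cmod (f x))\<^sup>2 + (cmod (g x))\<^sup>2"
      using sum_squares_bound[of "cmod (f x)" "cmod (g x)"]
        mult_nonneg_nonneg[OF norm_ge_zero[of "f x"] norm_ge_zero[of "g x"]] by linarith
    then show ?thesis by (simp add: norm_mult)
  qed
  then show "AE x in M. norm (f x * g x) \<le> norm ((cmod (f x))\<^sup>2 + (cmod (g x))\<^sup>2)"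
    by simp
qed

text \<open>The square of \<open>cmod (f x) - r * cmod (g x)\<close> has a nonnegative integral for
  every real \<open>r\<close>; the resulting quadratic in \<open>r\<close> therefore has nonpositive
  discriminant.\<close>

lemma L2_Cauchy_Schwarz:
  assumes f: "f \<in> L2_space M" and g: "g \<in> L2_space M"
  shows "(\<integral>x. cmod (f x * g x) \<partial>M) \<le> L2_norm M f * L2_norm M g"
proof -
  define X where "X = (\<integral>x. cmod (f x * g x) \<partial>M)"
  define A where "A = (\<integral>x. (cmod (f x))\<^sup>2 \<partial>M)"
  define B where "B = (\<integral>x. (cmod (g x))\<^sup>2 \<partial>M)"
  note [simp] = f[THEN L2_space_integrable_square] g[THEN L2_space_integrable_square]
    integrable_norm[OF L2_space_mult_integrable[OF f g]]
  have nn: "0 \<le> X" "0 \<le> A" "0 \<le> B"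
    by (auto simp: X_def A_def B_def)
  have quad: "0 \<le> A - 2 * r * X + r\<^sup>2 * B" for r
  proof -
    have "0 \<le> (\<integral>x. (cmod (f x) - r * cmod (g x))\<^sup>2 \<partial>M)"
      by simp
    also have "(\<lambda>x. (cmod (f x) - r * cmod (g x))\<^sup>2)
        = (\<lambda>x. (cmod (f x))\<^sup>2 - 2 * r * cmod (f x * g x) + r\<^sup>2 * (cmod (g x))\<^sup>2)"
      by (auto simp: norm_mult power2_eq_square algebra_simps)
    also have "(\<integral>x. (cmod (f x))\<^sup>2 - 2 * r * cmod (f x * g x) + r\<^sup>2 * (cmod (g x))\<^sup>2 \<partial>M)
        = A - 2 * r * X + r\<^sup>2 * B"
      by (simp add: A_def B_def X_def)
    finally show ?thesis .
  qed
  have "X\<^sup>2 \<le> A * B"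
  proof (cases "B = 0")
    case True
    have "X = 0"
    proof (rule ccontr)
      assume "X \<noteq> 0"
      \<comment> \<open>With \<open>B = 0\<close> the quadratic is linear in \<open>r\<close>; this
        \<open>r\<close> gives it the value -1.\<close>
      with quad[of "(A + 1) / (2 * X)"] True show False by simp
    qed
    with nn show ?thesis by simp
  next
    case False
    \<comment> \<open>\<open>X / B\<close> minimises the quadratic, with minimum
      \<open>A - X\<^sup>2 / B\<close>.\<close>
    with quad[of "X / B"] nn show ?thesis
      by (simp add: field_simps power2_eq_square)
  qed
  then have "X \<le> sqrt (A * B)" by (rule real_le_rsqrt)
  then show ?thesis
    by (simp add: X_def A_def B_def L2_norm_def real_sqrt_mult)
qed

lemma L2_Cauchy_Schwarz_integral:
  assumes "f \<in> L2_space M" "g \<in> L2_space M"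
  shows "cmod (\<integral>x. f x * g x \<partial>M) \<le> L2_norm M f * L2_norm M g"
  using integral_norm_bound[of M "\<lambda>x. f x * g x"] L2_Cauchy_Schwarz[OF assms] by linarith

lemma L2_space_cmult:
  assumes "f \<in> L2_space M" shows "(\<lambda>x. c * f x) \<in> L2_space M"
  using assms by (auto simp: L2_space_def norm_mult power_mult_distrib)

lemma L2_space_add:
  assumes f: "f \<in> L2_space M" and g: "g \<in> L2_space M"
  shows "(\<lambda>x. f x + g x) \<in> L2_space M"
proof -
  have "integrable M (\<lambda>x. (cmod (f x + g x))\<^sup>2)"
  proof (rule Bochner_Integration.integrable_bound)
    show "integrable M (\<lambda>x. 2 * (cmod (f x))\<^sup>2 + 2 * (cmod (g x))\<^sup>2)"
      using assms by (auto simp: L2_space_def)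
    show "(\<lambda>x. (cmod (f x + g x))\<^sup>2) \<in> borel_measurable M"
      using assms by (auto simp: L2_space_def)
    have "(cmod (f x + g x))\<^sup>2 \<le> 2 * (cmod (f x))\<^sup>2 + 2 * (cmod (g x))\<^sup>2" for x
    proof -
      have "(cmod (f x + g x))\<^sup>2 \<le> (cmod (f x) + cmod (g x))\<^sup>2"
        by (intro power_mono norm_triangle_ineq) auto
      also have "\<dots> \<le> 2 * (cmod (f x))\<^sup>2 + 2 * (cmod (g x))\<^sup>2"
        using sum_squares_bound[of "cmod (f x)" "cmod (g x)"] by (simp add: power2_sum)
      finally show ?thesis .
    qed
    then show "AE x in M. norm ((cmod (f x + g x))\<^sup>2) \<le> norm (2 * (cmod (f x))\<^sup>2 + 2 * (cmod (g x))\<^sup>2)"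
      by simp
  qed
  with assms show ?thesis by (auto simp: L2_space_def)
qed

lemma L2_space_diff:
  assumes "f \<in> L2_space M" "g \<in> L2_space M"
  shows "(\<lambda>x. f x - g x) \<in> L2_space M"
  using L2_space_add[OF assms(1) L2_space_cmult[OF assms(2), of "-1"]] by simp

lemma L2_norm_add_le:
  assumes f: "f \<in> L2_space M" and g: "g \<in> L2_space M"
  shows "L2_norm M (\<lambda>x. f x + g x) \<le> L2_norm M f + L2_norm M g"
proof -
  note [simp] = f[THEN L2_space_integrable_square] g[THEN L2_space_integrable_square]
    integrable_norm[OF L2_space_mult_integrable[OF f g]]
  have "(L2_norm M (\<lambda>x. f x + g x))\<^sup>2
      \<le> (\<integral>x. (cmod (f x))\<^sup>2 + 2 * cmod (f x * g x) + (cmod (g x))\<^sup>2 \<partial>M)"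
    unfolding L2_norm_square
  proof (rule integral_mono)
    fix x
    have "(cmod (f x + g x))\<^sup>2 \<le> (cmod (f x) + cmod (g x))\<^sup>2"
      by (intro power_mono norm_triangle_ineq) auto
    then show "(cmod (f x + g x))\<^sup>2 \<le> (cmod (f x))\<^sup>2 + 2 * cmod (f x * g x) + (cmod (g x))\<^sup>2"
      by (simp add: power2_sum norm_mult)
  qed (use L2_space_add[OF f g] in \<open>auto simp: L2_space_def\<close>)
  also have "\<dots> = (L2_norm M f)\<^sup>2 + 2 * (\<integral>x. cmod (f x * g x) \<partial>M) + (L2_norm M g)\<^sup>2"
    by (simp add: L2_norm_square)
  also have "\<dots> \<le> (L2_norm M f + L2_norm M g)\<^sup>2"
    using L2_Cauchy_Schwarz[OF f g] by (simp add: power2_sum)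
  finally show ?thesis
    by (rule power2_le_imp_le) simp
qed

lemma L2_norm_minus_commute: "L2_norm M (\<lambda>x. f x - g x) = L2_norm M (\<lambda>x. g x - f x)"
  by (simp add: L2_norm_def norm_minus_commute)

lemma L2_norm_diff_abs_le:
  assumes f: "f \<in> L2_space M" and g: "g \<in> L2_space M"
  shows "\<bar>L2_norm M f - L2_norm M g\<bar> \<le> L2_norm M (\<lambda>x. f x - g x)"
  using L2_norm_add_le[OF L2_space_diff[OF f g] g] L2_norm_add_le[OF L2_space_diff[OF g f] f]
  by (simp add: L2_norm_minus_commute[of M g f])

lemma L2_space_bounded:
  assumes "finite_measure M" "f \<in> borel_measurable M" "\<And>x. x \<in> space M \<Longrightarrow> cmod (f x) \<le> B"
  shows "f \<in> L2_space M"
proof -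
  have "integrable M (\<lambda>x. (cmod (f x))\<^sup>2)"
  proof (rule finite_measure.integrable_const_bound[OF assms(1)])
    show "AE x in M. norm ((cmod (f x))\<^sup>2) \<le> B\<^sup>2"
      using assms(3) by (auto intro!: power_mono)
  qed (use assms(2) in auto)
  with assms(2) show ?thesis by (simp add: L2_space_def)
qed

subsection \<open>Smooth functions\<close>

definition smooth_fun :: "(real \<Rightarrow> real) \<Rightarrow> bool" where
  "smooth_fun f \<longleftrightarrow> (\<forall>k x. (deriv ^^ k) f field_differentiable (at x))"

text \<open>Smooth functions are the largest class closed under differentiation, so exhibiting a
  class \<open>A\<close> closed under it replaces an induction over iterated derivatives. The
  alternative \<open>smooth_fun f'\<close> allows a derivative to leave \<open>A\<close> for
  functions already known to be smooth.\<close>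

lemma smooth_fun_coinduct:
  assumes A: "A f"
    and step: "\<And>f. A f \<Longrightarrow> \<exists>f'. (\<forall>x. (f has_field_derivative f' x) (at x)) \<and> (A f' \<or> smooth_fun f')"
  shows "smooth_fun f"
proof -
  have "A ((deriv ^^ k) f) \<or> smooth_fun ((deriv ^^ k) f)" for k
  proof (induction k)
    case (Suc k)
    show ?case
    proof (cases "A ((deriv ^^ k) f)")
      case True
      then obtain f' where f': "\<And>x. ((deriv ^^ k) f has_field_derivative f' x) (at x)"
        and "A f' \<or> smooth_fun f'" using step by blast
      moreover have "(deriv ^^ Suc k) f = f'"
        using f' by (auto intro!: ext DERIV_imp_deriv)
      ultimately show ?thesis by simp
    next
      case False
      with Suc have s: "smooth_fun ((deriv ^^ k) f)" by simp
      have "smooth_fun (deriv ((deriv ^^ k) f))"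
        unfolding smooth_fun_def
      proof (intro allI)
        fix j x
        show "(deriv ^^ j) (deriv ((deriv ^^ k) f)) field_differentiable at x"
          using s[unfolded smooth_fun_def, rule_format, of "Suc j" x] by (simp only: funpow_Suc_right o_def)
      qed
      then show ?thesis by simp
    qed
  qed (use A in simp)
  then have "(deriv ^^ k) f field_differentiable at x" for k x
  proof -
    consider "A ((deriv ^^ k) f)" | "smooth_fun ((deriv ^^ k) f)"
      using \<open>\<And>k. A ((deriv ^^ k) f) \<or> smooth_fun ((deriv ^^ k) f)\<close> by blast
    then show ?thesis
    proof cases
      case 1
      then show ?thesis using step unfolding field_differentiable_def by blast
    next
      case 2
      then show ?thesis unfolding smooth_fun_def by (metis funpow_0)
    qed
  qed
  then show ?thesis by (simp add: smooth_fun_def)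
qed

lemma smooth_fun_has_deriv:
  assumes "smooth_fun f"
  shows "(f has_field_derivative deriv f x) (at x)" and "smooth_fun (deriv f)"
proof -
  show "(f has_field_derivative deriv f x) (at x)"
    using assms unfolding smooth_fun_def by (metis DERIV_deriv_iff_field_differentiable funpow_0)
  show "smooth_fun (deriv f)"
    unfolding smooth_fun_def
  proof (intro allI)
    fix j x
    show "(deriv ^^ j) (deriv f) field_differentiable at x"
      using assms[unfolded smooth_fun_def, rule_format, of "Suc j" x] by (simp only: funpow_Suc_right o_def)
  qed
qed

lemma smooth_fun_add:
  assumes "smooth_fun f" "smooth_fun g"
  shows "smooth_fun (\<lambda>x. f x + g x)"
proof (rule smooth_fun_coinduct[where A = "\<lambda>h. \<exists>f g. smooth_fun f \<and> smooth_fun g \<and> h = (\<lambda>x. f x + g x)"])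
  show "\<exists>f' g'. smooth_fun f' \<and> smooth_fun g' \<and> (\<lambda>x. f x + g x) = (\<lambda>x. f' x + g' x)"
    using assms by blast
  fix h :: "real \<Rightarrow> real"
  assume "\<exists>f g. smooth_fun f \<and> smooth_fun g \<and> h = (\<lambda>x. f x + g x)"
  then obtain f g where *: "smooth_fun f" "smooth_fun g" "h = (\<lambda>x. f x + g x)" by blast
  then have "\<forall>x. (h has_field_derivative deriv f x + deriv g x) (at x)"
    by (auto intro!: derivative_eq_intros smooth_fun_has_deriv)
  then show "\<exists>h'. (\<forall>x. (h has_field_derivative h' x) (at x)) \<and>
      ((\<exists>f g. smooth_fun f \<and> smooth_fun g \<and> h' = (\<lambda>x. f x + g x)) \<or> smooth_fun h')"
    using *(1,2) smooth_fun_has_deriv(2)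
    by (intro exI[of _ "\<lambda>x. deriv f x + deriv g x"]) blast
qed

text \<open>Differentiating a product leaves the set of products, but not the set of their sums.\<close>

inductive sum_of_products :: "(real \<Rightarrow> real) \<Rightarrow> bool" where
  prod: "smooth_fun f \<Longrightarrow> smooth_fun g \<Longrightarrow> sum_of_products (\<lambda>x. f x * g x)"
| add: "sum_of_products f \<Longrightarrow> sum_of_products g \<Longrightarrow> sum_of_products (\<lambda>x. f x + g x)"

lemma smooth_fun_mult:
  assumes "smooth_fun f" "smooth_fun g"
  shows "smooth_fun (\<lambda>x. f x * g x)"
proof (rule smooth_fun_coinduct[where A = sum_of_products])
  show "sum_of_products (\<lambda>x. f x * g x)" using assms by (rule sum_of_products.prod)
  fix h assume "sum_of_products h"
  then have "\<exists>h'. (\<forall>x. (h has_field_derivative h' x) (at x)) \<and> sum_of_products h'"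
  proof induction
    case (prod f g)
    then show ?case
      by (intro exI[of _ "\<lambda>x. deriv f x * g x + f x * deriv g x"])
         (auto intro!: derivative_eq_intros sum_of_products.intros smooth_fun_has_deriv)
  next
    case (add f g)
    then obtain f' g' where "\<forall>x. (f has_field_derivative f' x) (at x)" "sum_of_products f'"
      "\<forall>x. (g has_field_derivative g' x) (at x)" "sum_of_products g'" by blast
    then show ?case
      by (intro exI[of _ "\<lambda>x. f' x + g' x"])
         (auto intro!: derivative_eq_intros sum_of_products.intros)
  qed
  then show "\<exists>h'. (\<forall>x. (h has_field_derivative h' x) (at x)) \<and> (sum_of_products h' \<or> smooth_fun h')"
    by blast
qed

text \<open>The factor \<open>c\<close> makes the class closed under differentiation: the chain rule
  turns \<open>c\<close> into \<open>c * a\<close>.\<close>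

lemma smooth_fun_affine:
  assumes "smooth_fun f"
  shows "smooth_fun (\<lambda>x. c * f (a * x + b))"
proof (rule smooth_fun_coinduct[where A = "\<lambda>h. \<exists>c f. smooth_fun f \<and> h = (\<lambda>x. c * f (a * x + b))"])
  fix h :: "real \<Rightarrow> real"
  assume "\<exists>c f. smooth_fun f \<and> h = (\<lambda>x. c * f (a * x + b))"
  then obtain c f where *: "smooth_fun f" "h = (\<lambda>x. c * f (a * x + b))" by blast
  have "(h has_field_derivative (c * a) * deriv f (a * x + b)) (at x)" for x
    unfolding *(2)
    by (auto intro!: derivative_eq_intros DERIV_chain2[OF smooth_fun_has_deriv(1)[OF *(1)]])
  then show "\<exists>h'. (\<forall>x. (h has_field_derivative h' x) (at x)) \<and>
      ((\<exists>c f. smooth_fun f \<and> h' = (\<lambda>x. c * f (a * x + b))) \<or> smooth_fun h')"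
    using smooth_fun_has_deriv(2)[OF *(1)]
    by (intro exI[of _ "\<lambda>x. (c * a) * deriv f (a * x + b)"]) blast
qed (use assms in blast)

lemma smooth_fun_trig: "smooth_fun (\<lambda>x. c * cos (a * x) + d * sin (a * x))"
proof (rule smooth_fun_coinduct[where A = "\<lambda>h. \<exists>c d. h = (\<lambda>x. c * cos (a * x) + d * sin (a * x))"])
  fix h :: "real \<Rightarrow> real"
  assume "\<exists>c d. h = (\<lambda>x. c * cos (a * x) + d * sin (a * x))"
  then obtain c d where h: "h = (\<lambda>x. c * cos (a * x) + d * sin (a * x))" by blast
  have "(h has_field_derivative (d * a) * cos (a * x) + (- c * a) * sin (a * x)) (at x)" for x
    unfolding h by (auto intro!: derivative_eq_intros)
  then show "\<exists>h'. (\<forall>x. (h has_field_derivative h' x) (at x)) \<and>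
      ((\<exists>c d. h' = (\<lambda>x. c * cos (a * x) + d * sin (a * x))) \<or> smooth_fun h')"
    by (intro exI[of _ "\<lambda>x. (d * a) * cos (a * x) + (- c * a) * sin (a * x)"] conjI disjI1) blast+
qed blast

section \<open>A smooth bump and a smooth step\<close>

definition flat_exp :: "real poly \<Rightarrow> real \<Rightarrow> real" where
  "flat_exp p x = (if 0 < x then poly p (inverse x) * exp (- inverse x) else 0)"

lemma flat_exp_tendsto_0: "(flat_exp p \<longlongrightarrow> 0) (at_right 0)"
proof -
  have "((\<lambda>y. poly p y * exp (- y)) \<longlongrightarrow> (\<Sum>i\<le>degree p. coeff p i * 0)) at_top"
  proof -
    have "((\<lambda>y. \<Sum>i\<le>degree p. coeff p i * (y ^ i / exp y)) \<longlongrightarrow> (\<Sum>i\<le>degree p. coeff p i * 0)) at_top"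
      by (intro tendsto_sum tendsto_mult tendsto_const tendsto_power_div_exp_0)
    then show ?thesis
      by (simp add: poly_altdef sum_distrib_right exp_minus divide_inverse mult.assoc)
  qed
  then have "((\<lambda>x. poly p (inverse x) * exp (- inverse x)) \<longlongrightarrow> 0) (at_right 0)"
    using filterlim_compose[OF _ filterlim_inverse_at_top_right] by simp
  moreover have "\<forall>\<^sub>F x in at_right 0. poly p (inverse x) * exp (- inverse x) = flat_exp p x"
    by (auto simp: eventually_at_right_field flat_exp_def intro: exI[of _ 1])
  ultimately show ?thesis by (rule Lim_transform_eventually)
qed

text \<open>With y = 1/x, differentiation in x is -y^2 times differentiation in y, and the
  y-derivative of p(y) exp(-y) is (p' - p)(y) exp(-y). The polynomial parameter thus makes the
  family closed under differentiation, which is all that the coinduction asks for;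
  \<open>[:0, 0, 1:]\<close> is y^2.\<close>

lemma flat_exp_has_deriv:
  "(flat_exp p has_field_derivative flat_exp ([:0, 0, 1:] * (p - pderiv p)) x) (at x)"
proof -
  consider "x < 0" | "x = 0" | "x > 0" by linarith
  then show ?thesis
  proof cases
    case 1
    have "((\<lambda>x. 0) has_field_derivative 0) (at x)" by simp
    then show ?thesis
      by (rule has_field_derivative_transform_within_open[where S = "{..<0}", THEN DERIV_cong])
         (use 1 in \<open>auto simp: flat_exp_def\<close>)
  next
    case 2
    \<comment> \<open>To the right of 0 the difference quotient is itself a member of the family,
      the one for the polynomial \<open>[:0, 1:] * p\<close>.\<close>
    have "((\<lambda>y. flat_exp p y / y) \<longlongrightarrow> 0) (at_right 0)"
      using flat_exp_tendsto_0[of "[:0, 1:] * p"]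
      by (rule Lim_transform_eventually)
         (auto simp: flat_exp_def divide_inverse intro!: exI[of _ 1] simp: eventually_at_right_field)
    moreover have "((\<lambda>y. flat_exp p y / y) \<longlongrightarrow> 0) (at_left 0)"
      by (rule Lim_transform_eventually[OF tendsto_const])
         (auto simp: flat_exp_def intro!: exI[of _ "-1"] simp: eventually_at_left_field)
    ultimately have "((\<lambda>y. flat_exp p y / y) \<longlongrightarrow> 0) (at 0)"
      by (simp add: filterlim_at_split)
    then show ?thesis
      by (simp add: has_field_derivative_iff 2) (simp add: flat_exp_def)
  next
    case 3
    have "((\<lambda>x. poly p (inverse x) * exp (- inverse x)) has_field_derivative
        flat_exp ([:0, 0, 1:] * (p - pderiv p)) x) (at x)"
      using 3 by (auto intro!: derivative_eq_intros DERIV_chain2[OF poly_DERIV]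
          simp: flat_exp_def power2_eq_square algebra_simps)
    then show ?thesis
      by (rule has_field_derivative_transform_within_open[where S = "{0<..}"])
         (use 3 in \<open>auto simp: flat_exp_def\<close>)
  qed
qed

lemma smooth_fun_flat_exp: "smooth_fun (flat_exp p)"
  by (rule smooth_fun_coinduct[where A = "\<lambda>h. \<exists>p. h = flat_exp p"])
     (use flat_exp_has_deriv in blast)+

definition bump :: "real \<Rightarrow> real" where
  "bump x = flat_exp [:1:] x * flat_exp [:1:] (1 - x)"

lemma smooth_fun_bump: "smooth_fun bump"
proof -
  have "smooth_fun (\<lambda>x. flat_exp [:1:] x * (1 * flat_exp [:1:] (- 1 * x + 1)))"
    by (intro smooth_fun_mult smooth_fun_affine smooth_fun_flat_exp)
  then show ?thesis by (simp add: bump_def[abs_def])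
qed

lemma bump_bounds: "0 \<le> bump x" "bump x \<le> 1"
  by (auto simp: bump_def flat_exp_def mult_le_one)

lemma bump_pos_iff: "0 < bump x \<longleftrightarrow> 0 < x \<and> x < 1"
  by (auto simp: bump_def flat_exp_def)

lemma bump_eq_0: "x \<le> 0 \<or> 1 \<le> x \<Longrightarrow> bump x = 0"
  by (auto simp: bump_def flat_exp_def)

text \<open>An antiderivative of \<open>bump\<close>, normalised by its total increase
  \<open>d\<close>, is constant off the unit interval because \<open>bump\<close> vanishes
  there.\<close>

lemma smooth_step_exists:
  obtains \<eta> \<eta>' :: "real \<Rightarrow> real" and K :: real where
    "smooth_fun \<eta>" "\<And>x. (\<eta> has_field_derivative \<eta>' x) (at x)"
    "\<And>x. x \<le> 0 \<Longrightarrow> \<eta> x = 0" "\<And>x. 1 \<le> x \<Longrightarrow> \<eta> x = 1" "\<And>x. 0 \<le> \<eta> x" "\<And>x. \<eta> x \<le> 1"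
    "\<And>x. \<bar>\<eta>' x\<bar> \<le> K" "\<And>x. x \<le> 0 \<or> 1 \<le> x \<Longrightarrow> \<eta>' x = 0"
proof -
  have "continuous_on UNIV bump"
    by (meson DERIV_continuous_on has_field_derivative_at_within smooth_fun_bump smooth_fun_has_deriv(1))
  then have "\<exists>F. \<forall>x. - \<infinity> < ereal x \<longrightarrow> ereal x < \<infinity> \<longrightarrow> (F has_vector_derivative bump x) (at x)"
    by (intro einterval_antiderivative) (auto simp: continuous_on_eq_continuous_at)
  then obtain F where F: "\<And>x. (F has_field_derivative bump x) (at x)"
    by (auto simp: has_real_derivative_iff_has_vector_derivative)
  have mono: "F x \<le> F y" if "x \<le> y" for x y
    using that F bump_bounds by (intro DERIV_nonneg_imp_nondecreasing[OF that]) blast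
  have cont: "continuous_on S F" for S
    using F by (meson DERIV_continuous_on has_field_derivative_at_within)
  have left: "F x = F 0" if "x \<le> 0" for x
    using that F bump_eq_0 by (cases "x = 0") (auto intro!: DERIV_isconst2[of x 0 F 0, symmetric]
      cont DERIV_cong[OF F])
  have right: "F x = F 1" if "1 \<le> x" for x
    using that F bump_eq_0 by (cases "x = 1") (auto intro!: DERIV_isconst2[of 1 x F x]
      cont DERIV_cong[OF F])
  have "F 0 < F 1"
    by (rule DERIV_pos_imp_increasing_open[of 0 1 F])
       (use F bump_pos_iff cont in auto)
  define d where "d = F 1 - F 0"
  have d: "0 < d" using \<open>F 0 < F 1\<close> by (simp add: d_def)
  define \<eta> where "\<eta> x = (F x - F 0) / d" for x
  define \<eta>' where "\<eta>' x = bump x / d" for x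
  have der: "(\<eta> has_field_derivative \<eta>' x) (at x)" for x
    unfolding \<eta>_def \<eta>'_def using d by (auto intro!: derivative_eq_intros F)
  have "smooth_fun (\<lambda>x. (1 / d) * bump (1 * x + 0))"
    by (intro smooth_fun_affine smooth_fun_bump)
  then have "smooth_fun \<eta>'" by (simp add: \<eta>'_def[abs_def])
  \<comment> \<open>The class consisting of \<open>\<eta>\<close> alone suffices, since its
    derivative is already known to be smooth.\<close>
  then have "smooth_fun \<eta>"
    using der by (intro smooth_fun_coinduct[where A = "\<lambda>h. h = \<eta>"]) auto
  moreover have "\<eta> x = 0" if "x \<le> 0" for x
    using left[OF that] by (simp add: \<eta>_def)
  moreover have "\<eta> x = 1" if "1 \<le> x" for x
    using right[OF that] d by (simp add: \<eta>_def d_def)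
  moreover have "0 \<le> \<eta> x" for x
    using mono[of 0 x] left[of x] d by (cases "0 \<le> x") (auto simp: \<eta>_def)
  moreover have "\<eta> x \<le> 1" for x
    using mono[of x 1] right[of x] d by (cases "x \<le> 1") (auto simp: \<eta>_def d_def)
  moreover have "\<bar>\<eta>' x\<bar> \<le> 1 / d" for x
    using bump_bounds d by (simp add: \<eta>'_def divide_right_mono)
  moreover have "\<eta>' x = 0" if "x \<le> 0 \<or> 1 \<le> x" for x
    using bump_eq_0[OF that] by (simp add: \<eta>'_def)
  ultimately show ?thesis using der that by blast
qed

section \<open>Integration over bounded open intervals\<close>

lemma lebesgue_on_Ioo_FTC:
  fixes F :: "real \<Rightarrow> 'a::euclidean_space"
  assumes "a \<le> b" "\<And>x. x \<in> {a..b} \<Longrightarrow> (F has_vector_derivative f x) (at x within {a..b})"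
    and f: "continuous_on {a..b} f"
  shows "integrable (lebesgue_on {a<..<b}) f" "(\<integral>x. f x \<partial>lebesgue_on {a<..<b}) = F b - F a"
proof -
  have "f absolutely_integrable_on {a<..<b}"
    using set_integrable_subset[OF absolutely_integrable_continuous_real[OF f], of "{a<..<b}"]
    by (simp add: greaterThanLessThan_subseteq_atLeastAtMost_iff)
  then show int: "integrable (lebesgue_on {a<..<b}) f"
    by (simp add: set_integrable_def integrable_restrict_space)
  have "(f has_integral F b - F a) {a..b}"
    by (rule fundamental_theorem_of_calculus) (use assms in auto)
  then show "(\<integral>x. f x \<partial>lebesgue_on {a<..<b}) = F b - F a"
    using int by (simp add: lebesgue_integral_eq_integral has_integral_Icc_iff_Ioo integral_unique)
qed

lemma finite_measure_lebesgue_on_Ioo: "finite_measure (lebesgue_on {a<..<b::real})"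
  by (cases "a \<le> b") (auto intro!: finite_measureI simp: emeasure_restrict_space)

lemma L2_space_integrable:
  assumes "finite_measure M" "f \<in> L2_space M"
  shows "integrable M f"
  using L2_space_mult_integrable[OF assms(2) L2_space_bounded[OF assms(1), of "\<lambda>_. 1" 1]] by simp

lemma integrable_bounded_scaleR:
  fixes g :: "'a \<Rightarrow> complex"
  assumes "integrable M g" "h \<in> borel_measurable M" "\<And>x. x \<in> space M \<Longrightarrow> \<bar>h x\<bar> \<le> B"
  shows "integrable M (\<lambda>x. h x *\<^sub>R g x)"
proof (rule Bochner_Integration.integrable_bound)
  show "integrable M (\<lambda>x. B *\<^sub>R g x)" using assms(1) by simp
  show "AE x in M. norm (h x *\<^sub>R g x) \<le> norm (B *\<^sub>R g x)"
    using assms(3) by (auto intro!: mult_right_mono order_trans[OF _ abs_ge_self])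
qed (use assms in auto)

lemma borel_measurable_lebesgue_on_continuous:
  fixes f :: "real \<Rightarrow> 'a::real_normed_vector"
  assumes "continuous_on {a..b} f"
  shows "f \<in> borel_measurable (lebesgue_on {a<..<b})"
  by (rule continuous_imp_measurable_on_sets_lebesgue)
     (auto intro: continuous_on_subset[OF assms])

lemma integrable_leb01_continuous:
  fixes u :: "real \<Rightarrow> 'a::euclidean_space"
  assumes "continuous_on {0..1} u"
  shows "integrable leb01 u"
  using set_integrable_subset[OF absolutely_integrable_continuous_real[OF assms], of "{0<..<1}"]
  by (simp add: set_integrable_def integrable_restrict_space greaterThanLessThan_subseteq_atLeastAtMost_iff)

lemma smooth_fun_continuous: "smooth_fun f \<Longrightarrow> continuous_on S f"
  by (meson DERIV_continuous_on has_field_derivative_at_within smooth_fun_has_deriv(1))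

subsection \<open>Integration by parts for weak derivatives\<close>

text \<open>Multiplying a smooth function by \<open>\<zeta> n\<close> turns it into a test function.
  The derivative \<open>\<zeta>' n\<close> is of size \<open>K / \<delta> n\<close> but within the
  unit interval lives on two layers of width of order \<open>\<delta> n\<close>, so its mass stays
  bounded while it concentrates at the endpoints. The bound 1/4 on \<open>\<delta> n\<close> keeps
  the layers apart.\<close>

locale cutoff =
  fixes \<zeta> \<zeta>' :: "nat \<Rightarrow> real \<Rightarrow> real" and \<delta> :: "nat \<Rightarrow> real" and K :: real
  assumes smooth: "\<And>n. smooth_fun (\<zeta> n)"
    and has_deriv: "\<And>n x. (\<zeta> n has_field_derivative \<zeta>' n x) (at x)"
    and \<delta>: "\<And>n. 0 < \<delta> n" "\<And>n. \<delta> n < 1 / 4" "\<delta> \<longlonglongrightarrow> 0"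
    and zero: "\<And>n x. x \<le> \<delta> n \<or> 1 - \<delta> n \<le> x \<Longrightarrow> \<zeta> n x = 0"
    and bound: "\<And>n x. \<bar>\<zeta> n x\<bar> \<le> 1"
    and one: "\<And>n x. 2 * \<delta> n \<le> x \<Longrightarrow> x \<le> 1 - 2 * \<delta> n \<Longrightarrow> \<zeta> n x = 1"
    and deriv_zero: "\<And>n x. 2 * \<delta> n \<le> x \<Longrightarrow> x \<le> 1 - 2 * \<delta> n \<Longrightarrow> \<zeta>' n x = 0"
    and deriv_bound: "\<And>n x. \<bar>\<zeta>' n x\<bar> \<le> K / \<delta> n" and K: "0 \<le> K"
begin

lemma deriv_eq: "deriv (\<zeta> n) = \<zeta>' n"
  using has_deriv by (auto intro!: ext DERIV_imp_deriv)

lemma continuous: "continuous_on S (\<zeta> n)" "continuous_on S (\<zeta>' n)"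
  using smooth_fun_continuous[OF smooth] smooth_fun_continuous[OF smooth_fun_has_deriv(2)[OF smooth]]
  by (auto simp: deriv_eq)

lemma measurable [measurable]:
  "\<zeta> n \<in> borel_measurable (lebesgue_on {a<..<b})" "\<zeta>' n \<in> borel_measurable (lebesgue_on {a<..<b})"
  by (auto intro!: borel_measurable_lebesgue_on_continuous continuous)

lemma eventually_inside:
  assumes "0 < x" "x < 1"
  shows "\<forall>\<^sub>F n in sequentially. 2 * \<delta> n \<le> x \<and> x \<le> 1 - 2 * \<delta> n"
proof -
  have "\<forall>\<^sub>F n in sequentially. \<delta> n < min x (1 - x) / 2"
    using assms by (intro order_tendstoD[OF \<delta>(3)]) auto
  then show ?thesis by eventually_elim auto
qed

lemma tendsto_one: "0 < x \<Longrightarrow> x < 1 \<Longrightarrow> (\<lambda>n. \<zeta> n x) \<longlonglongrightarrow> 1"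
  by (rule Lim_transform_eventually[OF tendsto_const])
     (use eventually_inside[of x] one in \<open>auto elim: eventually_mono\<close>)

lemma deriv_tendsto_zero: "0 < x \<Longrightarrow> x < 1 \<Longrightarrow> (\<lambda>n. \<zeta>' n x) \<longlonglongrightarrow> 0"
  by (rule Lim_transform_eventually[OF tendsto_const])
     (use eventually_inside[of x] deriv_zero in \<open>auto elim: eventually_mono\<close>)

lemma test_function_cutoff_mult:
  assumes "smooth_fun \<psi>"
  shows "test_function (\<lambda>x. \<zeta> n x * \<psi> x)"
proof -
  have "closure {x. \<zeta> n x * \<psi> x \<noteq> 0} \<subseteq> {\<delta> n..1 - \<delta> n}"
  proof (rule closure_minimal)
    show "{x. \<zeta> n x * \<psi> x \<noteq> 0} \<subseteq> {\<delta> n..1 - \<delta> n}"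
    proof
      fix x assume "x \<in> {x. \<zeta> n x * \<psi> x \<noteq> 0}"
      with zero[of x n] show "x \<in> {\<delta> n..1 - \<delta> n}"
        by (cases "x \<le> \<delta> n"; cases "1 - \<delta> n \<le> x") auto
    qed
  qed simp
  moreover from this have "compact (closure {x. \<zeta> n x * \<psi> x \<noteq> 0})"
    by (meson bounded_closed_interval bounded_subset closed_closure compact_eq_bounded_closed)
  moreover have "{\<delta> n..1 - \<delta> n} \<subseteq> {0<..<1}"
    using \<delta>(1)[of n] by auto
  ultimately show ?thesis
    using smooth_fun_mult[OF smooth assms] by (auto simp: test_function_def smooth_fun_def)
qed

lemma integral_tendsto:
  fixes g :: "real \<Rightarrow> complex"
  assumes "integrable leb01 g"
  shows "(\<lambda>n. \<integral>x. \<zeta> n x *\<^sub>R g x \<partial>leb01) \<longlonglongrightarrow> (\<integral>x. g x \<partial>leb01)"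
proof (rule integral_dominated_convergence[where w = "\<lambda>x. cmod (g x)"])
  show "AE x in leb01. (\<lambda>n. \<zeta> n x *\<^sub>R g x) \<longlonglongrightarrow> g x"
    by (rule AE_I2) (auto intro!: tendsto_eq_intros tendsto_one)
  show "AE x in leb01. norm (\<zeta> n x *\<^sub>R g x) \<le> cmod (g x)" for n
    using bound by (auto intro!: AE_I2 mult_left_le_one_le)
qed (use assms in auto)

text \<open>The weak derivative is tested with \<open>\<zeta> n x * \<psi> x\<close>. In the product
  rule the terms that keep \<open>\<zeta> n\<close> converge by dominated convergence, which forces
  the limit of the remaining one.\<close>

lemma weak_integral_by_parts_limit:
  assumes g: "g \<in> L2_space leb01" and w: "w \<in> L2_space leb01"
    and weak: "is_weak_deriv g w" and \<psi>: "smooth_fun \<psi>"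
  shows "(\<lambda>n. \<integral>x. \<zeta>' n x *\<^sub>R (\<psi> x *\<^sub>R g x) \<partial>leb01)
    \<longlonglongrightarrow> - (\<integral>x. \<psi> x *\<^sub>R w x \<partial>leb01) - (\<integral>x. deriv \<psi> x *\<^sub>R g x \<partial>leb01)"
proof -
  have cont: "continuous_on {0..1} \<psi>" "continuous_on {0..1} (deriv \<psi>)"
    using smooth_fun_continuous \<psi> smooth_fun_has_deriv(2) by blast+
  have mult: "integrable leb01 (\<lambda>x. h x *\<^sub>R u x)"
    if "continuous_on {0..1} h" "u \<in> L2_space leb01" for h :: "real \<Rightarrow> real" and u
  proof -
    have "compact (h ` {0..1})" using that(1) by (intro compact_continuous_image) auto
    then obtain B where "\<And>x. x \<in> {0..1} \<Longrightarrow> \<bar>h x\<bar> \<le> B"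
      by (metis compact_imp_bounded bounded_real imageI)
    then show ?thesis
      using that by (intro integrable_bounded_scaleR[of _ _ _ B] L2_space_integrable
        finite_measure_lebesgue_on_Ioo borel_measurable_lebesgue_on_continuous) auto
  qed
  have "(\<integral>x. \<zeta>' n x *\<^sub>R (\<psi> x *\<^sub>R g x) \<partial>leb01)
      = - (\<integral>x. \<zeta> n x *\<^sub>R (\<psi> x *\<^sub>R w x) \<partial>leb01) - (\<integral>x. \<zeta> n x *\<^sub>R (deriv \<psi> x *\<^sub>R g x) \<partial>leb01)" for n
  proof -
    have "deriv (\<lambda>x. \<zeta> n x * \<psi> x) x = \<zeta>' n x * \<psi> x + \<zeta> n x * deriv \<psi> x" for x
      by (rule DERIV_imp_deriv)
         (auto intro!: derivative_eq_intros has_deriv smooth_fun_has_deriv(1)[OF \<psi>])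
    then have "(\<integral>x. (\<zeta>' n x * \<psi> x + \<zeta> n x * deriv \<psi> x) *\<^sub>R g x \<partial>leb01)
        = - (\<integral>x. (\<zeta> n x * \<psi> x) *\<^sub>R w x \<partial>leb01)"
      using weak[unfolded is_weak_deriv_def, rule_format, OF test_function_cutoff_mult[OF \<psi>, of n]] by simp
    moreover have "(\<integral>x. (\<zeta>' n x * \<psi> x + \<zeta> n x * deriv \<psi> x) *\<^sub>R g x \<partial>leb01)
        = (\<integral>x. (\<zeta>' n x * \<psi> x) *\<^sub>R g x \<partial>leb01) + (\<integral>x. (\<zeta> n x * deriv \<psi> x) *\<^sub>R g x \<partial>leb01)"
      unfolding scaleR_add_left
      by (intro Bochner_Integration.integral_add mult g continuous_intros continuous cont)
    ultimately show ?thesis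
      by (simp add: algebra_simps)
  qed
  moreover have "(\<lambda>n. - (\<integral>x. \<zeta> n x *\<^sub>R (\<psi> x *\<^sub>R w x) \<partial>leb01) - (\<integral>x. \<zeta> n x *\<^sub>R (deriv \<psi> x *\<^sub>R g x) \<partial>leb01))
      \<longlonglongrightarrow> - (\<integral>x. \<psi> x *\<^sub>R w x \<partial>leb01) - (\<integral>x. deriv \<psi> x *\<^sub>R g x \<partial>leb01)"
    by (intro tendsto_intros integral_tendsto mult g w cont)
  ultimately show ?thesis by simp
qed

text \<open>A weight vanishing linearly at both ends is of order \<open>\<delta> n\<close> on the
  layers and compensates the size \<open>K / \<delta> n\<close> of \<open>\<zeta>' n\<close>.
  Integrability of \<open>g\<close> then gives dominated convergence, with no reference to boundary
  values of \<open>g\<close>.\<close>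

lemma boundary_limit_zero:
  fixes g :: "real \<Rightarrow> complex"
  assumes g: "integrable leb01 g" and \<psi>: "\<psi> \<in> borel_measurable leb01"
    and lip: "\<And>x. x \<in> {0<..<1} \<Longrightarrow> \<bar>\<psi> x\<bar> \<le> B * x" "\<And>x. x \<in> {0<..<1} \<Longrightarrow> \<bar>\<psi> x\<bar> \<le> B * (1 - x)"
  shows "(\<lambda>n. \<integral>x. \<zeta>' n x *\<^sub>R (\<psi> x *\<^sub>R g x) \<partial>leb01) \<longlonglongrightarrow> 0"
proof -
  have B: "0 \<le> B" using lip(1)[of "1/2"] by simp
  have est: "\<bar>\<zeta>' n x * \<psi> x\<bar> \<le> 2 * K * B" if "x \<in> {0<..<1}" for n x
  proof -
    consider "2 * \<delta> n \<le> x" "x \<le> 1 - 2 * \<delta> n" | "\<bar>\<psi> x\<bar> \<le> B * (2 * \<delta> n)"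
    proof -
      have "\<bar>\<psi> x\<bar> \<le> B * (2 * \<delta> n)" if "x \<le> 2 * \<delta> n \<or> 1 - 2 * \<delta> n \<le> x"
      proof -
        have "min x (1 - x) \<le> 2 * \<delta> n" using that by auto
        then have "B * min x (1 - x) \<le> B * (2 * \<delta> n)" using B by (rule mult_left_mono)
        moreover have "\<bar>\<psi> x\<bar> \<le> B * min x (1 - x)" using lip[OF \<open>x \<in> {0<..<1}\<close>] by (auto simp: min_def)
        ultimately show ?thesis by linarith
      qed
      then show ?thesis using that by (meson linear)
    qed
    then show ?thesis
    proof cases
      case 1
      then show ?thesis using deriv_zero B K by simp
    next
      case 2
      have "\<bar>\<zeta>' n x * \<psi> x\<bar> \<le> (K / \<delta> n) * (B * (2 * \<delta> n))"
        unfolding abs_mult using deriv_bound 2 \<delta>(1)[of n] K by (intro mult_mono) auto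
      also have "\<dots> = 2 * K * B" using \<delta>(1)[of n] by (simp add: field_simps)
      finally show ?thesis .
    qed
  qed
  have "(\<lambda>n. \<integral>x. \<zeta>' n x *\<^sub>R (\<psi> x *\<^sub>R g x) \<partial>leb01) \<longlonglongrightarrow> (\<integral>x. 0 \<partial>leb01)"
  proof (rule integral_dominated_convergence[where w = "\<lambda>x. 2 * K * B * cmod (g x)"])
    show "AE x in leb01. (\<lambda>n. \<zeta>' n x *\<^sub>R (\<psi> x *\<^sub>R g x)) \<longlonglongrightarrow> 0"
      by (rule AE_I2) (auto intro!: tendsto_eq_intros deriv_tendsto_zero)
    show "AE x in leb01. norm (\<zeta>' n x *\<^sub>R (\<psi> x *\<^sub>R g x)) \<le> 2 * K * B * cmod (g x)" for n
      using est by (intro AE_I2) (auto simp: abs_mult[symmetric] mult.assoc[symmetric] intro!: mult_right_mono)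
  qed (use g \<psi> in auto)
  then show ?thesis by simp
qed

text \<open>
  \<open>- \<zeta>' n\<close> acts in the limit like a Dirac mass at \<open>1\<close> minus one at \<open>0\<close>. For affine functions this is
  immediate from the fundamental theorem, so only functions vanishing at both ends need an estimate.
\<close>

lemma boundary_limit_vanishing:
  fixes E :: "real \<Rightarrow> complex"
  assumes E: "continuous_on {0..1} E" "E 0 = 0" "E 1 = 0"
  shows "(\<lambda>n. \<integral>x. \<zeta>' n x *\<^sub>R E x \<partial>leb01) \<longlonglongrightarrow> 0"
proof (rule LIMSEQ_I)
  fix r :: real assume "0 < r"
  \<comment> \<open>The layers have total length at most \<open>4 * \<delta> n\<close>, so the
    integral is at most \<open>K / \<delta> n * e * (4 * \<delta> n) = 4 * K * e\<close>; the
    summand 1 covers \<open>K = 0\<close>.\<close>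
  define e where "e = r / (4 * K + 1)"
  have e: "0 < e" "4 * K * e < r" using \<open>0 < r\<close> K by (auto simp: e_def field_simps)
  obtain d0 where d0: "0 < d0" "\<And>x. x \<in> {0..1} \<Longrightarrow> dist x 0 < d0 \<Longrightarrow> dist (E x) (E 0) < e"
    using E(1) e(1) unfolding continuous_on_iff by (metis atLeastAtMost_iff order_refl zero_le_one)
  obtain d1 where d1: "0 < d1" "\<And>x. x \<in> {0..1} \<Longrightarrow> dist x 1 < d1 \<Longrightarrow> dist (E x) (E 1) < e"
    using E(1) e(1) unfolding continuous_on_iff by (metis atLeastAtMost_iff order_refl zero_le_one)
  have "\<forall>\<^sub>F n in sequentially. \<delta> n < min d0 d1 / 2"
    using d0 d1 by (intro order_tendstoD[OF \<delta>(3)]) auto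
  then obtain N where N: "\<And>n. N \<le> n \<Longrightarrow> \<delta> n < min d0 d1 / 2"
    by (auto simp: eventually_sequentially)
  have "norm ((\<integral>x. \<zeta>' n x *\<^sub>R E x \<partial>leb01) - 0) < r" if "N \<le> n" for n
  proof -
    define A where "A = {0<..2 * \<delta> n} \<union> {1 - 2 * \<delta> n..<1}"
    have A: "A \<subseteq> {0<..<1}" using \<delta>(1,2)[of n] by (auto simp: A_def)
    have Am: "A \<in> sets lebesgue" by (simp add: A_def)
    interpret finite_measure leb01 by (rule finite_measure_lebesgue_on_Ioo)
    have "measure leb01 A = measure lebesgue A"
      using A by (simp add: measure_restrict_space)
    also have "\<dots> \<le> measure lebesgue {0<..2 * \<delta> n} + measure lebesgue {1 - 2 * \<delta> n..<1}"
      unfolding A_def by (rule measure_Un_le) auto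
    also have "\<dots> = 4 * \<delta> n" using \<delta>(1)[of n] by simp
    finally have meas: "measure leb01 A \<le> 4 * \<delta> n" .
    have intA: "integrable leb01 (\<lambda>x. (K / \<delta> n * e) * indicator A x)"
      using A Am by (intro integrable_mult_right integrable_real_indicator)
        (auto simp: sets_restrict_space_iff emeasure_eq_measure)
    have "norm (\<integral>x. \<zeta>' n x *\<^sub>R E x \<partial>leb01) \<le> (\<integral>x. (K / \<delta> n * e) * indicator A x \<partial>leb01)"
    proof (rule Bochner_Integration.integral_norm_bound_integral)
      show "integrable leb01 (\<lambda>x. \<zeta>' n x *\<^sub>R E x)"
      proof (rule integrable_bounded_scaleR[of _ _ _ "K / \<delta> n"])
        show "integrable leb01 E"
          by (rule integrable_leb01_continuous[OF E(1)])
      qed (use deriv_bound in auto)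
      show "norm (\<zeta>' n x *\<^sub>R E x) \<le> (K / \<delta> n * e) * indicator A x" if "x \<in> space leb01" for x
      proof (cases "x \<in> A")
        case True
        have x: "x \<in> {0..1}" using that by simp
        have "cmod (E x) \<le> e"
        proof (cases "x \<le> 2 * \<delta> n")
          case True
          then show ?thesis using d0(2)[OF x] N[OF \<open>N \<le> n\<close>] x E by (simp add: dist_norm)
        next
          case False
          with \<open>x \<in> A\<close> have "1 - 2 * \<delta> n \<le> x" by (simp add: A_def)
          then show ?thesis using d1(2)[OF x] N[OF \<open>N \<le> n\<close>] x E by (simp add: dist_norm)
        qed
        then show ?thesis
          using True mult_mono[OF deriv_bound[of n x] \<open>cmod (E x) \<le> e\<close>] K \<delta>(1)[of n] by simp
      next
        case False
        with that have "\<zeta>' n x = 0" by (intro deriv_zero) (auto simp: A_def)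
        with False show ?thesis by simp
      qed
    qed (rule intA)
    also have "\<dots> = (K / \<delta> n * e) * measure leb01 A"
      using A by (simp add: Int_absorb2)
    also have "\<dots> \<le> (K / \<delta> n * e) * (4 * \<delta> n)"
      using meas e K \<delta>(1)[of n] by (intro mult_left_mono) auto
    also have "\<dots> < r" using e \<delta>(1)[of n] by (simp add: field_simps)
    finally show ?thesis by simp
  qed
  then show "\<exists>N. \<forall>n\<ge>N. norm ((\<integral>x. \<zeta>' n x *\<^sub>R E x \<partial>leb01) - 0) < r" by blast
qed

lemma boundary_limit:
  fixes H :: "real \<Rightarrow> complex"
  assumes H: "continuous_on {0..1} H"
  shows "(\<lambda>n. \<integral>x. \<zeta>' n x *\<^sub>R H x \<partial>leb01) \<longlonglongrightarrow> H 0 - H 1"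
proof -
  define R where "R x = H 0 + x *\<^sub>R (H 1 - H 0)" for x
  have R: "continuous_on {0..1} R" unfolding R_def by (intro continuous_intros)
  \<comment> \<open>The product of \<open>\<zeta> n\<close> and \<open>R\<close> vanishes at both
    ends, so the \<open>\<zeta>' n\<close> term equals minus the integral of
    \<open>\<zeta> n\<close> times the constant slope of \<open>R\<close>, whose limit is that
    slope.\<close>
  have ftc: "(\<integral>x. \<zeta>' n x *\<^sub>R R x + \<zeta> n x *\<^sub>R (H 1 - H 0) \<partial>leb01) = \<zeta> n 1 *\<^sub>R R 1 - \<zeta> n 0 *\<^sub>R R 0" for n
  proof (rule lebesgue_on_Ioo_FTC(2))
    show "((\<lambda>x. \<zeta> n x *\<^sub>R R x) has_vector_derivative \<zeta>' n x *\<^sub>R R x + \<zeta> n x *\<^sub>R (H 1 - H 0)) (at x within {0..1})" for x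
    proof -
      have "(R has_vector_derivative 0 + (x *\<^sub>R 0 + 1 *\<^sub>R (H 1 - H 0))) (at x within {0..1})"
        unfolding R_def
        by (intro has_vector_derivative_add has_vector_derivative_const has_vector_derivative_scaleR DERIV_ident)
      from has_vector_derivative_scaleR[OF has_field_derivative_at_within[OF has_deriv] this]
      show ?thesis by (simp add: add.commute)
    qed
  qed (auto intro!: continuous_intros continuous R)
  have ends: "\<zeta> n 1 = 0" "\<zeta> n 0 = 0" for n using zero \<delta>(1)[of n] by auto
  have "(\<integral>x. \<zeta>' n x *\<^sub>R R x + \<zeta> n x *\<^sub>R (H 1 - H 0) \<partial>leb01)
      = (\<integral>x. \<zeta>' n x *\<^sub>R R x \<partial>leb01) + (\<integral>x. \<zeta> n x *\<^sub>R (H 1 - H 0) \<partial>leb01)" for n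
    by (intro Bochner_Integration.integral_add integrable_leb01_continuous continuous_intros continuous R)
  then have "(\<integral>x. \<zeta>' n x *\<^sub>R R x \<partial>leb01) = - (\<integral>x. \<zeta> n x *\<^sub>R (H 1 - H 0) \<partial>leb01)" for n
    using ftc[of n] by (simp add: ends eq_neg_iff_add_eq_0)
  moreover have "(\<lambda>n. - (\<integral>x. \<zeta> n x *\<^sub>R (H 1 - H 0) \<partial>leb01)) \<longlonglongrightarrow> - (\<integral>x. H 1 - H 0 \<partial>leb01)"
    by (intro tendsto_minus integral_tendsto integrable_leb01_continuous continuous_intros)
  moreover have "(\<integral>x. H 1 - H 0 \<partial>leb01) = H 1 - H 0"
    by (simp add: measure_restrict_space)
  ultimately have "(\<lambda>n. \<integral>x. \<zeta>' n x *\<^sub>R R x \<partial>leb01) \<longlonglongrightarrow> H 0 - H 1" by simp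
  moreover have "(\<lambda>n. \<integral>x. \<zeta>' n x *\<^sub>R (H x - R x) \<partial>leb01) \<longlonglongrightarrow> 0"
    by (intro boundary_limit_vanishing continuous_intros H R) (simp_all add: R_def)
  ultimately have "(\<lambda>n. (\<integral>x. \<zeta>' n x *\<^sub>R R x \<partial>leb01) + (\<integral>x. \<zeta>' n x *\<^sub>R (H x - R x) \<partial>leb01)) \<longlonglongrightarrow> (H 0 - H 1) + 0"
    by (rule tendsto_add)
  moreover have "(\<integral>x. \<zeta>' n x *\<^sub>R R x \<partial>leb01) + (\<integral>x. \<zeta>' n x *\<^sub>R (H x - R x) \<partial>leb01) = (\<integral>x. \<zeta>' n x *\<^sub>R H x \<partial>leb01)" for n
  proof -
    have "(\<integral>x. \<zeta>' n x *\<^sub>R R x + \<zeta>' n x *\<^sub>R (H x - R x) \<partial>leb01)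
        = (\<integral>x. \<zeta>' n x *\<^sub>R R x \<partial>leb01) + (\<integral>x. \<zeta>' n x *\<^sub>R (H x - R x) \<partial>leb01)"
      by (intro Bochner_Integration.integral_add integrable_leb01_continuous continuous_intros continuous R H)
    moreover have "\<zeta>' n x *\<^sub>R R x + \<zeta>' n x *\<^sub>R (H x - R x) = \<zeta>' n x *\<^sub>R H x" for x
      by (simp add: scaleR_diff_right)
    ultimately show ?thesis by simp
  qed
  ultimately show ?thesis by simp
qed

end

lemma cutoff_exists: "\<exists>\<zeta> \<zeta>' \<delta> K. cutoff \<zeta> \<zeta>' \<delta> K"
proof -
  obtain \<eta> \<eta>' K where \<eta>: "smooth_fun \<eta>" "\<And>x. (\<eta> has_field_derivative \<eta>' x) (at x)"
    "\<And>x. x \<le> 0 \<Longrightarrow> \<eta> x = 0" "\<And>x. 1 \<le> x \<Longrightarrow> \<eta> x = 1" "\<And>x. 0 \<le> \<eta> x" "\<And>x. \<eta> x \<le> 1"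
    "\<And>x. \<bar>\<eta>' x\<bar> \<le> K" "\<And>x. x \<le> 0 \<or> 1 \<le> x \<Longrightarrow> \<eta>' x = 0"
    using smooth_step_exists by metis
  \<comment> \<open>The offset 5 makes even \<open>\<delta> 0\<close> smaller than 1/4.\<close>
  define \<delta> :: "nat \<Rightarrow> real" where "\<delta> n = 1 / (real n + 5)" for n
  \<comment> \<open>The first step rises from \<open>\<delta> n\<close> to
    \<open>2 * \<delta> n\<close>, the second from \<open>1 - 2 * \<delta> n\<close> to
    \<open>1 - \<delta> n\<close>; the second cancels the first near 1. Having two steps doubles the
    constant \<open>K\<close>.\<close>
  define \<zeta> where "\<zeta> n x = \<eta> (x / \<delta> n - 1) - \<eta> ((x - 1) / \<delta> n + 2)" for n x
  define \<zeta>' where "\<zeta>' n x = \<eta>' (x / \<delta> n - 1) / \<delta> n - \<eta>' ((x - 1) / \<delta> n + 2) / \<delta> n" for n x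
  have \<delta>: "0 < \<delta> n" "\<delta> n < 1 / 4" for n by (auto simp: \<delta>_def field_simps)
  have "\<delta> \<longlonglongrightarrow> 0"
    using LIMSEQ_ignore_initial_segment[OF lim_1_over_n, of 5] by (simp add: \<delta>_def[abs_def])
  moreover have "smooth_fun (\<zeta> n)" for n
  proof -
    have "smooth_fun (\<lambda>x. 1 * \<eta> ((1 / \<delta> n) * x + (-1)) + (-1) * \<eta> ((1 / \<delta> n) * x + (2 - 1 / \<delta> n)))"
      by (intro smooth_fun_add smooth_fun_affine \<eta>)
    then show ?thesis by (simp add: \<zeta>_def[abs_def] diff_divide_distrib add_diff_eq diff_add_eq)
  qed
  moreover have "(\<zeta> n has_field_derivative \<zeta>' n x) (at x)" for n x
    unfolding \<zeta>_def \<zeta>'_def using \<delta>[of n]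
    by (auto intro!: derivative_eq_intros DERIV_chain2[OF \<eta>(2)] simp: field_simps)
  moreover have "\<zeta> n x = 0" if "x \<le> \<delta> n \<or> 1 - \<delta> n \<le> x" for n x
    using that
  proof
    assume "x \<le> \<delta> n"
    then have "x / \<delta> n - 1 \<le> 0" "(x - 1) / \<delta> n + 2 \<le> 0" using \<delta>[of n] by (auto simp: field_simps)
    then show ?thesis by (simp add: \<zeta>_def \<eta>)
  next
    assume "1 - \<delta> n \<le> x"
    then have "1 \<le> x / \<delta> n - 1" "1 \<le> (x - 1) / \<delta> n + 2" using \<delta>[of n] by (auto simp: field_simps)
    then show ?thesis by (simp add: \<zeta>_def \<eta>)
  qed
  moreover have "\<bar>\<zeta> n x\<bar> \<le> 1" for n x
    using \<eta>(5,6)[of "x / \<delta> n - 1"] \<eta>(5,6)[of "(x - 1) / \<delta> n + 2"] by (auto simp: \<zeta>_def)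
  moreover have "\<zeta> n x = 1 \<and> \<zeta>' n x = 0" if "2 * \<delta> n \<le> x" "x \<le> 1 - 2 * \<delta> n" for n x
  proof -
    have "1 \<le> x / \<delta> n - 1" "(x - 1) / \<delta> n + 2 \<le> 0" using \<delta>[of n] that by (auto simp: field_simps)
    then show ?thesis by (simp add: \<zeta>_def \<zeta>'_def \<eta>)
  qed
  moreover have "\<bar>\<zeta>' n x\<bar> \<le> (2 * K) / \<delta> n" for n x
  proof -
    have "\<bar>\<eta>' (x / \<delta> n - 1) - \<eta>' ((x - 1) / \<delta> n + 2)\<bar> \<le> 2 * K"
      using \<eta>(7)[of "x / \<delta> n - 1"] \<eta>(7)[of "(x - 1) / \<delta> n + 2"] by linarith
    then show ?thesis
      using \<delta>[of n] by (simp add: \<zeta>'_def diff_divide_distrib[symmetric] divide_right_mono)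
  qed
  moreover have "0 \<le> 2 * K" using \<eta>(7)[of 0] by linarith
  ultimately have "cutoff \<zeta> \<zeta>' \<delta> (2 * K)"
    using \<delta> by (intro cutoff.intro; blast)
  then show ?thesis by blast
qed

text \<open>The limit of the \<open>\<zeta>' n\<close> term is computed twice, once from the weak
  derivative and once from a continuous representative of \<open>g\<close>; uniqueness of limits
  equates the results.\<close>

lemma weak_integral_by_parts:
  assumes g: "g \<in> L2_space leb01" and w: "w \<in> L2_space leb01"
    and weak: "is_weak_deriv g w" and \<psi>: "smooth_fun \<psi>"
    and tr: "has_trace g 0 c0" "has_trace g 1 c1"
  shows "(\<integral>x. \<psi> x *\<^sub>R w x \<partial>leb01) = \<psi> 1 *\<^sub>R c1 - \<psi> 0 *\<^sub>R c0 - (\<integral>x. deriv \<psi> x *\<^sub>R g x \<partial>leb01)"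
proof -
  obtain \<zeta> \<zeta>' \<delta> K where "cutoff \<zeta> \<zeta>' \<delta> K" using cutoff_exists by blast
  then interpret cutoff \<zeta> \<zeta>' \<delta> K .
  obtain G0 G1 where G0: "continuous_on {0..1} G0" "AE x in leb01. G0 x = g x" "G0 0 = c0"
    and G1: "continuous_on {0..1} G1" "AE x in leb01. G1 x = g x" "G1 1 = c1"
    using tr unfolding has_trace_def by blast
  have ae: "(\<integral>x. \<zeta>' n x *\<^sub>R (h x *\<^sub>R G x) \<partial>leb01) = (\<integral>x. \<zeta>' n x *\<^sub>R (h x *\<^sub>R G' x) \<partial>leb01)"
    if "AE x in leb01. G x = G' x" "G \<in> borel_measurable leb01" "G' \<in> borel_measurable leb01"
      "continuous_on {0..1} h" for n G G' and h :: "real \<Rightarrow> real"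
    using that borel_measurable_lebesgue_on_continuous[OF that(4)]
    by (intro integral_cong_AE) (auto elim: AE_mp)
  note meas = borel_measurable_lebesgue_on_continuous[OF G0(1)]
    borel_measurable_lebesgue_on_continuous[OF G1(1)] L2_space_measurable[OF g]
  \<comment> \<open>The two traces may come from different continuous representatives; weighting with \<open>x\<close> isolates
    their values at \<open>1\<close>.\<close>
  have lims: "(\<lambda>n. \<integral>x. \<zeta>' n x *\<^sub>R (x *\<^sub>R G0 x) \<partial>leb01) \<longlonglongrightarrow> 0 *\<^sub>R G0 0 - 1 *\<^sub>R G0 1"
    "(\<lambda>n. \<integral>x. \<zeta>' n x *\<^sub>R (x *\<^sub>R G1 x) \<partial>leb01) \<longlonglongrightarrow> 0 *\<^sub>R G1 0 - 1 *\<^sub>R G1 1"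
    by (intro boundary_limit continuous_intros G0 G1)+
  have "AE x in leb01. G0 x = G1 x" using G0(2) G1(2) by (auto elim: AE_mp)
  then have "(\<integral>x. \<zeta>' n x *\<^sub>R (x *\<^sub>R G0 x) \<partial>leb01) = (\<integral>x. \<zeta>' n x *\<^sub>R (x *\<^sub>R G1 x) \<partial>leb01)" for n
    by (intro ae meas continuous_intros)
  then have "0 *\<^sub>R G0 0 - 1 *\<^sub>R G0 1 = 0 *\<^sub>R G1 0 - 1 *\<^sub>R G1 1"
    using LIMSEQ_unique[OF lims(1)] lims(2) by simp
  then have "G0 1 = c1" using G1(3) by simp
  moreover have "(\<lambda>n. \<integral>x. \<zeta>' n x *\<^sub>R (\<psi> x *\<^sub>R G0 x) \<partial>leb01) \<longlonglongrightarrow> \<psi> 0 *\<^sub>R G0 0 - \<psi> 1 *\<^sub>R G0 1"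
    by (intro boundary_limit continuous_intros G0 smooth_fun_continuous[OF \<psi>])
  moreover have "(\<integral>x. \<zeta>' n x *\<^sub>R (\<psi> x *\<^sub>R G0 x) \<partial>leb01) = (\<integral>x. \<zeta>' n x *\<^sub>R (\<psi> x *\<^sub>R g x) \<partial>leb01)" for n
    by (intro ae meas G0 smooth_fun_continuous[OF \<psi>])
  ultimately have "(\<lambda>n. \<integral>x. \<zeta>' n x *\<^sub>R (\<psi> x *\<^sub>R g x) \<partial>leb01) \<longlonglongrightarrow> \<psi> 0 *\<^sub>R c0 - \<psi> 1 *\<^sub>R c1"
    using G0(3) by simp
  from LIMSEQ_unique[OF this weak_integral_by_parts_limit[OF g w weak \<psi>]]
  show ?thesis by (simp add: algebra_simps)
qed

text \<open>Here the weight removes the boundary contribution, so no trace of \<open>g\<close>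
  enters. This is the form applied to the solution itself, whose derivative alone has prescribed
  boundary values.\<close>

lemma weak_integral_by_parts_vanishing:
  assumes g: "g \<in> L2_space leb01" and w: "w \<in> L2_space leb01"
    and weak: "is_weak_deriv g w" and \<psi>: "smooth_fun \<psi>" "\<psi> 0 = 0" "\<psi> 1 = 0"
  shows "(\<integral>x. \<psi> x *\<^sub>R w x \<partial>leb01) = - (\<integral>x. deriv \<psi> x *\<^sub>R g x \<partial>leb01)"
proof -
  obtain \<zeta> \<zeta>' \<delta> K where "cutoff \<zeta> \<zeta>' \<delta> K" using cutoff_exists by blast
  then interpret cutoff \<zeta> \<zeta>' \<delta> K .
  have "compact (deriv \<psi> ` {0..1})"
    by (intro compact_continuous_image smooth_fun_continuous smooth_fun_has_deriv \<psi>) auto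
  then obtain B where B: "\<And>x. x \<in> {0..1} \<Longrightarrow> \<bar>deriv \<psi> x\<bar> \<le> B"
    by (metis compact_imp_bounded bounded_real imageI)
  \<comment> \<open>Comparing with the endpoints, where \<open>\<psi>\<close> is 0, gives the linear
    vanishing that the boundary layer estimate requires.\<close>
  have lip: "\<bar>\<psi> x - \<psi> y\<bar> \<le> B * \<bar>x - y\<bar>" if "x \<in> {0..1}" "y \<in> {0..1}" for x y
    using field_differentiable_bound[of "{0..1}" \<psi> "deriv \<psi>" B y x] that B
      smooth_fun_has_deriv(1)[OF \<psi>(1)]
    by (auto intro: has_field_derivative_at_within simp: abs_minus_commute)
  have "(\<lambda>n. \<integral>x. \<zeta>' n x *\<^sub>R (\<psi> x *\<^sub>R g x) \<partial>leb01) \<longlonglongrightarrow> 0"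
  proof (rule boundary_limit_zero[where B = B])
    show "\<bar>\<psi> x\<bar> \<le> B * x" "\<bar>\<psi> x\<bar> \<le> B * (1 - x)" if "x \<in> {0<..<1}" for x
      using lip[of x 0] lip[of x 1] that \<psi> by auto
  qed (auto intro!: L2_space_integrable finite_measure_lebesgue_on_Ioo g
        borel_measurable_lebesgue_on_continuous smooth_fun_continuous \<psi>)
  from LIMSEQ_unique[OF this weak_integral_by_parts_limit[OF g w weak \<psi>(1)]]
  show ?thesis by (simp add: algebra_simps)
qed

subsection \<open>Cosine and exponential sums\<close>

lemma has_vector_derivative_cis_affine:
  "((\<lambda>s. cis (c * (s - t))) has_vector_derivative \<i> * of_real c * cis (c * (s - t))) (at s within S)"
  by (auto simp: has_vector_derivative_complex_iff intro!: derivative_eq_intros)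

text \<open>Parseval's identity for finite sums, kept general because it serves twice: for cosines
  in space and for exponentials in time.\<close>

lemma integral_square_orthogonal_sum:
  fixes u :: "nat \<Rightarrow> 'a \<Rightarrow> complex"
  assumes int: "\<And>n m. integrable M (\<lambda>x. u n x * cnj (u m x))"
    and orth: "\<And>n m. (\<integral>x. u n x * cnj (u m x) \<partial>M) = (if n = m then of_real (w n) else 0)"
  shows "(\<integral>x. (cmod (\<Sum>n<N. b n * u n x))\<^sup>2 \<partial>M) = (\<Sum>n<N. (cmod (b n))\<^sup>2 * w n)"
proof -
  have "complex_of_real (\<integral>x. (cmod (\<Sum>n<N. b n * u n x))\<^sup>2 \<partial>M)
      = (\<integral>x. (\<Sum>n<N. \<Sum>m<N. b n * cnj (b m) * (u n x * cnj (u m x))) \<partial>M)"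
    unfolding integral_complex_of_real[symmetric]
    by (intro Bochner_Integration.integral_cong refl)
       (simp add: complex_norm_square sum_product mult_ac del: of_real_power)
  also have "\<dots> = (\<Sum>n<N. \<Sum>m<N. b n * cnj (b m) * (\<integral>x. u n x * cnj (u m x) \<partial>M))"
    using int by simp
  also have "\<dots> = (\<Sum>n<N. b n * cnj (b n) * of_real (w n))"
    by (simp add: orth if_distrib[of "\<lambda>z. _ * z"] cong: if_cong)
  also have "\<dots> = of_real (\<Sum>n<N. (cmod (b n))\<^sup>2 * w n)"
    by (simp add: complex_norm_square del: of_real_power)
  finally show ?thesis by (simp only: of_real_eq_iff)
qed

definition cosine_sum :: "(nat \<Rightarrow> complex) \<Rightarrow> nat \<Rightarrow> real \<Rightarrow> complex" where
  "cosine_sum a N x = (\<Sum>n<N. a n * of_real (cos (real n * pi * x)))"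

lemma continuous_on_cosine_sum: "continuous_on S (cosine_sum a N)"
  unfolding cosine_sum_def[abs_def] by (intro continuous_intros)

lemma L2_space_leb01_continuous:
  assumes "continuous_on {0..1} u"
  shows "u \<in> L2_space leb01"
  unfolding L2_space_def
  by (auto intro!: borel_measurable_lebesgue_on_continuous[OF assms] integrable_leb01_continuous
      continuous_intros assms)

text \<open>The frequency is an integer rather than a natural number because the product formula for
  cosines produces \<open>n - m\<close>.\<close>

lemma integral_cos_pi: "(\<integral>x. cos (real_of_int k * pi * x) \<partial>leb01) = (if k = 0 then 1 else 0)"
proof (cases "k = 0")
  case False
  have "(\<integral>x. cos (real_of_int k * pi * x) \<partial>leb01)
      = sin (real_of_int k * pi * 1) / (real_of_int k * pi) - sin (real_of_int k * pi * 0) / (real_of_int k * pi)"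
  proof (rule lebesgue_on_Ioo_FTC(2))
    show "((\<lambda>x. sin (real_of_int k * pi * x) / (real_of_int k * pi)) has_vector_derivative
        cos (real_of_int k * pi * x)) (at x within {0..1})" for x
      unfolding has_real_derivative_iff_has_vector_derivative[symmetric]
      using False by (auto intro!: derivative_eq_intros)
  qed (auto intro!: continuous_intros)
  with False show ?thesis by (simp add: sin_integer_2pi mult.commute[of _ pi] sin_int_times_real)
qed (simp add: measure_restrict_space)

lemma cosine_orthogonality:
  "(\<integral>x. complex_of_real (cos (real n * pi * x)) * cnj (complex_of_real (cos (real m * pi * x))) \<partial>leb01)
    = (if n = m then of_real (if n = 0 then 1 else 1 / 2) else 0)"
proof -
  have "(\<integral>x. cos (real n * pi * x) * cos (real m * pi * x) \<partial>leb01)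
      = (\<integral>x. (cos (real_of_int (int n - int m) * pi * x) + cos (real_of_int (int n + int m) * pi * x)) / 2 \<partial>leb01)"
    by (intro Bochner_Integration.integral_cong refl) (unfold cos_times_cos, simp add: algebra_simps)
  also have "\<dots> = ((\<integral>x. cos (real_of_int (int n - int m) * pi * x) \<partial>leb01)
      + (\<integral>x. cos (real_of_int (int n + int m) * pi * x) \<partial>leb01)) / 2"
  proof -
    have i: "integrable leb01 (\<lambda>x. cos (real_of_int k * pi * x))" for k
      by (intro integrable_leb01_continuous continuous_intros)
    show ?thesis by (simp only: integral_divide_zero Bochner_Integration.integral_add[OF i i])
  qed
  also have "\<dots> = (if n = m then (if n = 0 then 1 else 1 / 2) else 0)"
    unfolding integral_cos_pi by auto
  finally show ?thesis
    by (simp add: of_real_mult[symmetric] del: of_real_mult of_real_divide)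
qed

text \<open>The squared norms of the cosines, which are orthogonal but not normalised.\<close>

definition cosine_weight :: "nat \<Rightarrow> real" where
  "cosine_weight n = (if n = 0 then 1 else 1 / 2)"

lemma L2_norm_cosine_sum:
  "(L2_norm leb01 (cosine_sum a N))\<^sup>2 = (\<Sum>n<N. (cmod (a n))\<^sup>2 * cosine_weight n)"
  unfolding L2_norm_square cosine_sum_def
  by (rule integral_square_orthogonal_sum)
     (auto simp: cosine_orthogonality cosine_weight_def simp del: complex_cnj_complex_of_real
       intro!: integrable_leb01_continuous continuous_intros)

text \<open>All the frequencies \<open>n\<^sup>2 \<pi>\<^sup>2\<close> are multiples of \<open>\<pi>\<^sup>2\<close>, so \<open>4 / \<pi>\<close> is a common period; it exceeds \<open>1\<close>.\<close>

lemma cis_orthogonality: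
  fixes n m :: nat and t :: real
  defines "u \<equiv> \<lambda>n s. cis ((real n * pi)\<^sup>2 * (s - t))"
  shows "(\<integral>s. u n s * cnj (u m s) \<partial>lebesgue_on {0<..<4 / pi}) = (if n = m then of_real (4 / pi) else 0)"
proof -
  define k where "k = int n ^ 2 - int m ^ 2"
  define c where "c = real_of_int k * pi\<^sup>2"
  have u: "u n s * cnj (u m s) = cis (c * (s - t))" for s
    by (simp add: u_def c_def k_def cis_mult cis_cnj power_mult_distrib algebra_simps)
  show ?thesis
  proof (cases "n = m")
    case True
    then show ?thesis
      unfolding u by (simp add: c_def k_def measure_restrict_space scaleR_conv_of_real)
  next
    case False
    then have "k \<noteq> 0" by (simp add: k_def power2_eq_iff_nonneg)
    then have c: "c \<noteq> 0" by (simp add: c_def)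
    have "(\<integral>s. cis (c * (s - t)) \<partial>lebesgue_on {0<..<4 / pi})
        = cis (c * (4 / pi - t)) / (\<i> * of_real c) - cis (c * (0 - t)) / (\<i> * of_real c)"
    proof (rule lebesgue_on_Ioo_FTC(2))
      show "((\<lambda>s. cis (c * (s - t)) / (\<i> * of_real c)) has_vector_derivative cis (c * (s - t)))
          (at s within {0..4 / pi})" for s
        using has_vector_derivative_divide[OF has_vector_derivative_cis_affine[of c t s], of "\<i> * of_real c"] c
        by simp
    qed (auto intro!: continuous_intros)
    \<comment> \<open>Since \<open>c\<close> is \<open>k\<close> times \<pi>^2, the length 4/\<pi>
      shifts the phase by 4 \<pi> \<open>k\<close>, two full turns for each unit of
      \<open>k\<close>.\<close>
    also have "c * (4 / pi - t) = c * (0 - t) + 2 * pi * real_of_int (2 * k)"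
      by (simp add: c_def power2_eq_square field_simps)
    also have "cis (c * (0 - t) + 2 * pi * real_of_int (2 * k)) = cis (c * (0 - t))"
      by (subst cis_mult[symmetric], subst cis_multiple_2pi) auto
    finally show ?thesis unfolding u using False by simp
  qed
qed

text \<open>The integrand is nonnegative and \<open>T \<le> 1 \<le> 4 / pi\<close>, so the time
  integral may be enlarged to the interval on which the exponentials are orthogonal. This keeps the
  bound independent of \<open>T\<close> and free of powers of the frequencies, which is where the
  hidden regularity comes from.\<close>

lemma exponential_sum_bound:
  fixes b :: "nat \<Rightarrow> complex" and N :: nat and t :: real
  assumes "0 \<le> T" "T \<le> 1"
  defines "p \<equiv> \<lambda>s. \<Sum>n<N. b n * cis ((real n * pi)\<^sup>2 * (s - t))"
  shows "p \<in> L2_space (lebesgue_on {0<..<T})"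
    and "L2_norm (lebesgue_on {0<..<T}) p \<le> sqrt (4 / pi * (\<Sum>n<N. (cmod (b n))\<^sup>2))"
proof -
  have cont: "continuous_on S p" for S unfolding p_def by (intro continuous_intros)
  have int: "integrable (lebesgue_on {0<..<r}) f" if "continuous_on UNIV f" for r and f :: "real \<Rightarrow> 'b::euclidean_space"
    using set_integrable_subset[OF absolutely_integrable_continuous_real[of 0 r f], of "{0<..<r}"]
      continuous_on_subset[OF that]
    by (simp add: set_integrable_def integrable_restrict_space greaterThanLessThan_subseteq_atLeastAtMost_iff)
  have int_square: "integrable (lebesgue_on {0<..<r}) (\<lambda>s. (cmod (p s))\<^sup>2)" for r
    by (intro int continuous_intros cont)
  show "p \<in> L2_space (lebesgue_on {0<..<T})"
    using int_square by (auto simp: L2_space_def intro!: borel_measurable_lebesgue_on_continuous cont)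
  have "1 \<le> 4 / pi" using pi_less_4 by simp
  then have "T \<le> 4 / pi" using assms(2) by linarith
  then have sub: "{0<..<T} \<subseteq> {0<..<4 / pi}"
    by (simp only: greaterThanLessThan_subseteq_greaterThanLessThan) simp
  have "(\<integral>s. (cmod (p s))\<^sup>2 \<partial>lebesgue_on {0<..<T})
      = integral {0<..<T} (\<lambda>s. (cmod (p s))\<^sup>2)"
    by (rule lebesgue_integral_eq_integral[OF int_square]) simp
  also have "\<dots> \<le> integral {0<..<4 / pi} (\<lambda>s. (cmod (p s))\<^sup>2)"
    by (intro integral_subset_le sub integrable_on_lebesgue_on int_square) auto
  also have "\<dots> = (\<integral>s. (cmod (p s))\<^sup>2 \<partial>lebesgue_on {0<..<4 / pi})"
    by (rule lebesgue_integral_eq_integral[OF int_square, symmetric]) simp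
  also have "\<dots> = (\<Sum>n<N. (cmod (b n))\<^sup>2 * (4 / pi))"
    unfolding p_def
    by (rule integral_square_orthogonal_sum) (auto simp: cis_orthogonality intro!: int continuous_intros)
  finally show "L2_norm (lebesgue_on {0<..<T}) p \<le> sqrt (4 / pi * (\<Sum>n<N. (cmod (b n))\<^sup>2))"
    by (simp add: L2_norm_def sum_distrib_left mult.commute)
qed

section \<open>Uniform density of cosine sums\<close>

definition real_cosine_sum :: "(real \<Rightarrow> real) \<Rightarrow> bool" where
  "real_cosine_sum f \<longleftrightarrow> (\<exists>N a. f = (\<lambda>x. \<Sum>n<N. a n * cos (real n * pi * x)))"

lemma real_cosine_sum_cos: "real_cosine_sum (\<lambda>x. cos (real n * pi * x))"
  unfolding real_cosine_sum_def
  by (intro exI[of _ "Suc n"] exI[of _ "\<lambda>k. if k = n then 1 else 0"])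
     (simp add: if_distrib[of "\<lambda>z. z * _"] cong: if_cong)

lemma real_cosine_sum_cmult: "real_cosine_sum f \<Longrightarrow> real_cosine_sum (\<lambda>x. c * f x)"
proof -
  assume "real_cosine_sum f"
  then obtain N a where "f = (\<lambda>x. \<Sum>n<N. a n * cos (real n * pi * x))"
    unfolding real_cosine_sum_def by blast
  then show ?thesis
    unfolding real_cosine_sum_def
    by (intro exI[of _ N] exI[of _ "\<lambda>n. c * a n"]) (simp add: sum_distrib_left mult.assoc)
qed

text \<open>Padding with zero coefficients brings two sums to a common length.\<close>

lemma sum_lessThan_extend:
  fixes a :: "nat \<Rightarrow> 'a::semiring_0"
  assumes "N \<le> L"
  shows "(\<Sum>n<N. a n * u n) = (\<Sum>n<L. (if n < N then a n else 0) * u n)"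
  using assms by (intro sum.mono_neutral_cong_left) auto

lemma real_cosine_sum_add:
  assumes "real_cosine_sum f" "real_cosine_sum g"
  shows "real_cosine_sum (\<lambda>x. f x + g x)"
proof -
  obtain N a M b where f: "f = (\<lambda>x. \<Sum>n<N. a n * cos (real n * pi * x))"
    and g: "g = (\<lambda>x. \<Sum>n<M. b n * cos (real n * pi * x))"
    using assms unfolding real_cosine_sum_def by blast
  have "(\<lambda>x. f x + g x) = (\<lambda>x. \<Sum>n<max N M.
      ((if n < N then a n else 0) + (if n < M then b n else 0)) * cos (real n * pi * x))"
    unfolding f g sum_lessThan_extend[of N "max N M", OF max.cobounded1]
      sum_lessThan_extend[of M "max N M", OF max.cobounded2]
    by (simp add: sum.distrib distrib_right)
  then show ?thesis unfolding real_cosine_sum_def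
    by (intro exI[of _ "max N M"] exI[of _ "\<lambda>n. (if n < N then a n else 0) + (if n < M then b n else 0)"])
qed

lemma real_cosine_sum_sum:
  "(\<And>i. i \<in> I \<Longrightarrow> real_cosine_sum (f i)) \<Longrightarrow> real_cosine_sum (\<lambda>x. \<Sum>i\<in>I. f i x)"
proof (induction I rule: infinite_finite_induct)
  case (insert i I)
  then show ?case by (simp add: real_cosine_sum_add)
qed (use real_cosine_sum_cmult[OF real_cosine_sum_cos, of 0] in simp_all)

lemma real_cosine_sum_mult:
  assumes "real_cosine_sum f" "real_cosine_sum g"
  shows "real_cosine_sum (\<lambda>x. f x * g x)"
proof -
  obtain N a M b where f: "f = (\<lambda>x. \<Sum>n<N. a n * cos (real n * pi * x))"
    and g: "g = (\<lambda>x. \<Sum>n<M. b n * cos (real n * pi * x))"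
    using assms unfolding real_cosine_sum_def by blast
  \<comment> \<open>The case distinction spells out the distance of \<open>i\<close> and
    \<open>j\<close>, since subtraction of natural numbers truncates.\<close>
  have prod: "cos (real i * pi * x) * cos (real j * pi * x)
      = 1 / 2 * (cos (real (if j \<le> i then i - j else j - i) * pi * x) + cos (real (i + j) * pi * x))" for i j x
  proof -
    have "cos (real (if j \<le> i then i - j else j - i) * pi * x) = cos (real i * pi * x - real j * pi * x)"
      by (cases "j \<le> i", simp_all add: of_nat_diff left_diff_distrib)
         (subst cos_minus[symmetric], simp)
    then show ?thesis by (simp add: cos_times_cos distrib_right)
  qed
  have "(a i * cos (real i * pi * x)) * (b j * cos (real j * pi * x)) = (a i * b j) * (1 / 2 *
      (cos (real (if j \<le> i then i - j else j - i) * pi * x) + cos (real (i + j) * pi * x)))" for i j x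
    unfolding prod[symmetric] by (simp only: mult_ac)
  then have "(\<lambda>x. f x * g x) = (\<lambda>x. \<Sum>i<N. \<Sum>j<M. (a i * b j) * (1 / 2 *
      (cos (real (if j \<le> i then i - j else j - i) * pi * x) + cos (real (i + j) * pi * x))))"
    by (simp only: f g sum_product)
  then show ?thesis
    by (simp only:) (intro real_cosine_sum_sum real_cosine_sum_cmult real_cosine_sum_add real_cosine_sum_cos)
qed

lemma real_cosine_sum_continuous: "real_cosine_sum f \<Longrightarrow> continuous_on S f"
  unfolding real_cosine_sum_def by (auto intro!: continuous_intros)

text \<open>Stone-Weierstrass for real-valued functions: cosine sums form an algebra by the product
  formula, and the cosine of frequency one is injective on the unit interval, so it separates
  points.\<close>

lemma real_cosine_sum_dense:
  assumes "continuous_on {0..1} f" "0 < e"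
  shows "\<exists>g. real_cosine_sum g \<and> (\<forall>x\<in>{0..1}. \<bar>f x - g x\<bar> < e)"
proof (rule Stone_Weierstrass_HOL)
  show "real_cosine_sum (\<lambda>x. c)" for c
    using real_cosine_sum_cmult[OF real_cosine_sum_cos, of c 0] by simp
  fix x y :: real
  assume xy: "x \<in> {0..1} \<and> y \<in> {0..1} \<and> x \<noteq> y"
  then have "cos (real 1 * pi * x) \<noteq> cos (real 1 * pi * y)"
    by (auto dest!: cos_inj_pi[rotated 4])
  then show "\<exists>f. real_cosine_sum f \<and> f x \<noteq> f y"
    using real_cosine_sum_cos by blast
qed (use assms in \<open>auto intro: real_cosine_sum_add real_cosine_sum_mult real_cosine_sum_continuous\<close>)

lemma cosine_sum_dense:
  fixes f :: "real \<Rightarrow> complex"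
  assumes f: "continuous_on {0..1} f" and "0 < e"
  obtains a N where "\<And>x. x \<in> {0..1} \<Longrightarrow> cmod (f x - cosine_sum a N x) < e"
proof -
  have "continuous_on {0..1} (\<lambda>x. Re (f x))" "continuous_on {0..1} (\<lambda>x. Im (f x))"
    using f by (auto intro: continuous_intros)
  then obtain g h where g: "real_cosine_sum g" "\<And>x. x \<in> {0..1} \<Longrightarrow> \<bar>Re (f x) - g x\<bar> < e / 2"
    and h: "real_cosine_sum h" "\<And>x. x \<in> {0..1} \<Longrightarrow> \<bar>Im (f x) - h x\<bar> < e / 2"
    using real_cosine_sum_dense[of _ "e / 2"] \<open>0 < e\<close> by (metis half_gt_zero)
  obtain N a M b where g': "g = (\<lambda>x. \<Sum>n<N. a n * cos (real n * pi * x))"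
    and h': "h = (\<lambda>x. \<Sum>n<M. b n * cos (real n * pi * x))"
    using g(1) h(1) unfolding real_cosine_sum_def by blast
  define c where "c n = Complex (if n < N then a n else 0) (if n < M then b n else 0)" for n
  have "cosine_sum c (max N M) x = Complex (g x) (h x)" for x
    unfolding g' h' sum_lessThan_extend[of N "max N M", OF max.cobounded1]
      sum_lessThan_extend[of M "max N M", OF max.cobounded2]
    by (simp add: cosine_sum_def complex_eq_iff c_def)
  moreover have "cmod (f x - Complex (g x) (h x)) < e" if "x \<in> {0..1}" for x
    using cmod_le[of "f x - Complex (g x) (h x)"] g(2)[OF that] h(2)[OF that] by simp
  ultimately show ?thesis using that by metis
qed

section \<open>Norm bounds by duality\<close>

lemma duality_continuous:
  assumes g: "g \<in> L2_space leb01" and M: "0 \<le> M"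
    and dual: "\<And>a N. cmod (\<integral>x. g x * cosine_sum a N x \<partial>leb01) \<le> M * L2_norm leb01 (cosine_sum a N)"
    and p: "continuous_on {0..1} p"
  shows "cmod (\<integral>x. g x * p x \<partial>leb01) \<le> M * L2_norm leb01 p"
proof (rule field_le_epsilon)
  fix r :: real assume "0 < r"
  \<comment> \<open>Replacing \<open>p\<close> by a cosine sum costs \<open>M * e\<close> on the
    right and \<open>L2_norm leb01 g * e\<close> on the left; \<open>e\<close> makes their sum at
    most \<open>r\<close>. As the interval has length one, a uniform error \<open>e\<close> is also
    an error \<open>e\<close> in L2.\<close>
  define e where "e = r / (M + L2_norm leb01 g + 1)"
  have pos: "0 < M + L2_norm leb01 g + 1" using M L2_norm_nonneg[of leb01 g] by linarith
  have e: "0 < e" "(M + L2_norm leb01 g) * e \<le> r"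
    using pos \<open>0 < r\<close> by (auto simp: e_def field_simps)
  obtain a N where q: "\<And>x. x \<in> {0..1} \<Longrightarrow> cmod (p x - cosine_sum a N x) < e"
    using cosine_sum_dense[OF p e(1)] by metis
  define q where "q = cosine_sum a N"
  have p2: "p \<in> L2_space leb01" and q2: "q \<in> L2_space leb01"
    by (auto intro!: L2_space_leb01_continuous p continuous_on_cosine_sum simp: q_def)
  have d2: "(\<lambda>x. q x - p x) \<in> L2_space leb01" using q2 p2 by (rule L2_space_diff)
  have "(L2_norm leb01 (\<lambda>x. q x - p x))\<^sup>2 \<le> (\<integral>x. e\<^sup>2 \<partial>leb01)"
    unfolding L2_norm_square
  proof (rule integral_mono)
    fix x assume "x \<in> space leb01"
    then have "cmod (q x - p x) \<le> e" using q[of x] by (simp add: q_def norm_minus_commute less_imp_le)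
    then show "(cmod (q x - p x))\<^sup>2 \<le> e\<^sup>2" by (intro power_mono) auto
  qed (use d2 in \<open>auto simp: L2_space_def intro!: integrable_leb01_continuous\<close>)
  also have "\<dots> = e\<^sup>2" by (simp add: measure_restrict_space)
  finally have d: "L2_norm leb01 (\<lambda>x. q x - p x) \<le> e"
    by (rule power2_le_imp_le) (use e(1) in simp)
  have "(\<integral>x. g x * p x \<partial>leb01) = (\<integral>x. g x * q x \<partial>leb01) - (\<integral>x. g x * (q x - p x) \<partial>leb01)"
    using L2_space_mult_integrable[OF g q2] L2_space_mult_integrable[OF g p2]
    by (simp add: right_diff_distrib)
  then have "cmod (\<integral>x. g x * p x \<partial>leb01) \<le> cmod (\<integral>x. g x * q x \<partial>leb01) + cmod (\<integral>x. g x * (q x - p x) \<partial>leb01)"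
    by (simp add: norm_triangle_ineq4)
  also have "\<dots> \<le> M * L2_norm leb01 q + L2_norm leb01 g * e"
    using dual[of a N] L2_Cauchy_Schwarz_integral[OF g d2] mult_left_mono[OF d, of "L2_norm leb01 g"]
    by (auto simp: q_def)
  also have "\<dots> \<le> M * (L2_norm leb01 p + e) + L2_norm leb01 g * e"
    using L2_norm_add_le[OF p2 d2] d M by (auto intro!: mult_left_mono)
  also have "\<dots> = M * L2_norm leb01 p + (M + L2_norm leb01 g) * e"
    by (simp add: algebra_simps)
  finally show "cmod (\<integral>x. g x * p x \<partial>leb01) \<le> M * L2_norm leb01 p + r"
    using e(2) by linarith
qed

text \<open>Testing with the conjugate of \<open>g\<close> would give the square of the norm of
  \<open>g\<close> at most \<open>M\<close> times that norm. That function need not be continuous,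
  so it is reached by two limits: \<open>k\<close> tends to infinity at fixed \<open>n\<close>, and
  then \<open>n\<close> does.\<close>

lemma L2_norm_le_by_cosine_duality:
  assumes g: "g \<in> L2_space leb01" and M: "0 \<le> M"
    and dual: "\<And>a N. cmod (\<integral>x. g x * cosine_sum a N x \<partial>leb01) \<le> M * L2_norm leb01 (cosine_sum a N)"
  shows "L2_norm leb01 g \<le> M"
proof -
  \<comment> \<open>\<open>h n \<circ> g\<close> is a bounded approximation of \<open>cnj \<circ> g\<close>, and a limit of continuous functions with the same
    bound, so that the estimate for continuous functions carries over by dominated convergence.\<close>
  define h where "h n z = cnj z / of_real (1 + cmod z / real (Suc n))" for n :: nat and z
  have den: "1 \<le> 1 + cmod z / real (Suc n)" for n z by simp
  have den_pos: "0 < 1 + cmod z / real (Suc n)" for n z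
    using den[of z n] by linarith
  have h_norm: "cmod (h n z) = cmod z / (1 + cmod z / real (Suc n))" for n z
    using den[of z n] by (simp add: h_def norm_divide del: of_real_add)
  have h_le: "cmod (h n z) \<le> cmod z" for n z
    unfolding h_norm pos_divide_le_eq[OF den_pos]
    using mult_left_mono[OF den[of z n], of "cmod z"] by simp
  have h_bound: "cmod (h n z) \<le> real (Suc n)" for n z
  proof -
    have "cmod z \<le> real (Suc n) * (1 + cmod z / real (Suc n))" by (simp add: field_simps)
    then show ?thesis
      unfolding h_norm pos_divide_le_eq[OF den_pos] .
  qed
  have h_mult: "z * h n z = of_real ((cmod z)\<^sup>2 / (1 + cmod z / real (Suc n)))" for n z
    by (simp add: h_def complex_norm_square[symmetric] del: of_real_add of_real_power)
  have h_cont: "continuous_on UNIV (h n)" for n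
  proof -
    have "complex_of_real (1 + cmod z / real (Suc n)) \<noteq> 0" for z
      using den[of z n] by (simp only: of_real_eq_0_iff)
    then show ?thesis unfolding h_def by (intro continuous_intros) auto
  qed
  note [measurable] = L2_space_measurable[OF g] borel_measurable_continuous_onI[OF h_cont]
  have g_int: "integrable leb01 g"
    by (intro L2_space_integrable finite_measure_lebesgue_on_Ioo g)
  \<comment> \<open>This notion of measurability supplies continuous functions \<open>c k\<close>
    converging to \<open>g\<close> almost everywhere.\<close>
  have "g measurable_on {0<..<1}"
    using L2_space_measurable[OF g] by (simp add: measurable_on_iff_borel_measurable)
  then obtain Z c where Z: "negligible Z" and c: "\<And>k. continuous_on UNIV (c k)"
    and lim: "\<And>x. x \<notin> Z \<Longrightarrow> (\<lambda>k. c k x) \<longlonglongrightarrow> (if x \<in> {0<..<1} then g x else 0)"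
    unfolding measurable_on_def by blast
  have "AE x in lebesgue. x \<notin> Z"
    using Z by (intro AE_not_in) (simp add: negligible_iff_null_sets)
  then have ae: "AE x in leb01. (\<lambda>k. c k x) \<longlonglongrightarrow> g x"
    by (subst AE_restrict_space_iff) (auto elim!: eventually_mono dest!: lim)
  have h_lim: "AE x in leb01. (\<lambda>k. h n (c k x)) \<longlonglongrightarrow> h n (g x)" for n
    using ae
  proof eventually_elim
    case (elim x)
    show ?case
      by (rule isCont_tendsto_compose[OF _ elim])
         (use h_cont in \<open>auto simp: continuous_on_eq_continuous_at\<close>)
  qed
  have hc: "continuous_on S (\<lambda>x. h n (c k x))" for S n k
    by (rule continuous_on_compose2[OF h_cont]) (auto intro: continuous_on_subset[OF c])
  note [measurable] = borel_measurable_lebesgue_on_continuous[OF hc]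
  \<comment> \<open>At fixed \<open>n\<close> the bound \<open>real (Suc n)\<close> on
    \<open>h n\<close> provides both dominating functions: a multiple of \<open>cmod (g x)\<close>
    for the pairing and a constant for the norm.\<close>
  have step: "cmod (\<integral>x. g x * h n (g x) \<partial>leb01) \<le> M * L2_norm leb01 (\<lambda>x. h n (g x))" for n
  proof (rule LIMSEQ_le)
    show "(\<lambda>k. cmod (\<integral>x. g x * h n (c k x) \<partial>leb01)) \<longlonglongrightarrow> cmod (\<integral>x. g x * h n (g x) \<partial>leb01)"
    proof (intro tendsto_norm integral_dominated_convergence[where w = "\<lambda>x. real (Suc n) * cmod (g x)"])
      show "AE x in leb01. (\<lambda>k. g x * h n (c k x)) \<longlonglongrightarrow> g x * h n (g x)"
        using h_lim[of n] by eventually_elim (intro tendsto_intros)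
      show "AE x in leb01. norm (g x * h n (c k x)) \<le> real (Suc n) * cmod (g x)" for k
      proof (rule AE_I2)
        fix x
        show "norm (g x * h n (c k x)) \<le> real (Suc n) * cmod (g x)"
          using mult_right_mono[OF h_bound[of n "c k x"] norm_ge_zero[of "g x"]]
          by (simp add: norm_mult mult.commute)
      qed
      show "(\<lambda>x. g x * h n (g x)) \<in> borel_measurable leb01"
        "\<And>k. (\<lambda>x. g x * h n (c k x)) \<in> borel_measurable leb01" by measurable
      show "integrable leb01 (\<lambda>x. real (Suc n) * cmod (g x))" using g_int by simp
    qed
    have "(\<lambda>k. L2_norm leb01 (\<lambda>x. h n (c k x))) \<longlonglongrightarrow> L2_norm leb01 (\<lambda>x. h n (g x))"
      unfolding L2_norm_def
    proof (intro tendsto_real_sqrt integral_dominated_convergence[where w = "\<lambda>x. (real (Suc n))\<^sup>2"])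
      show "AE x in leb01. (\<lambda>k. (cmod (h n (c k x)))\<^sup>2) \<longlonglongrightarrow> (cmod (h n (g x)))\<^sup>2"
        using h_lim[of n] by eventually_elim (intro tendsto_intros)
      show "AE x in leb01. norm ((cmod (h n (c k x)))\<^sup>2) \<le> (real (Suc n))\<^sup>2" for k
        using h_bound by (intro AE_I2) (simp del: of_nat_Suc add: power_mono)
      show "(\<lambda>x. (cmod (h n (g x)))\<^sup>2) \<in> borel_measurable leb01"
        "\<And>k. (\<lambda>x. (cmod (h n (c k x)))\<^sup>2) \<in> borel_measurable leb01" by measurable
    qed (auto intro: integrable_leb01_continuous)
    then show "(\<lambda>k. M * L2_norm leb01 (\<lambda>x. h n (c k x))) \<longlonglongrightarrow> M * L2_norm leb01 (\<lambda>x. h n (g x))"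
      by (intro tendsto_intros)
    show "\<exists>K. \<forall>k\<ge>K. cmod (\<integral>x. g x * h n (c k x) \<partial>leb01) \<le> M * L2_norm leb01 (\<lambda>x. h n (c k x))"
      using duality_continuous[OF g M dual hc] by blast
  qed
  have hg_L2: "(\<lambda>x. h n (g x)) \<in> L2_space leb01" for n
    by (rule L2_space_bounded[OF finite_measure_lebesgue_on_Ioo _ h_bound]) measurable
  have "(\<integral>x. (cmod (g x))\<^sup>2 / (1 + cmod (g x) / real (Suc n)) \<partial>leb01) \<le> M * L2_norm leb01 g" for n
  proof -
    have "(\<integral>x. (cmod (g x))\<^sup>2 / (1 + cmod (g x) / real (Suc n)) \<partial>leb01)
        \<le> cmod (complex_of_real (\<integral>x. (cmod (g x))\<^sup>2 / (1 + cmod (g x) / real (Suc n)) \<partial>leb01))"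
      by (simp only: norm_of_real abs_ge_self)
    also have "\<dots> = cmod (\<integral>x. g x * h n (g x) \<partial>leb01)"
      by (simp only: h_mult integral_complex_of_real)
    also have "\<dots> \<le> M * L2_norm leb01 (\<lambda>x. h n (g x))" by (rule step)
    also have "\<dots> \<le> M * L2_norm leb01 g"
      unfolding L2_norm_def
      using M g hg_L2[of n] h_le
      by (intro mult_left_mono real_sqrt_le_mono integral_mono power_mono) (auto simp: L2_space_def)
    finally show ?thesis .
  qed
  moreover have "(\<lambda>n. \<integral>x. (cmod (g x))\<^sup>2 / (1 + cmod (g x) / real (Suc n)) \<partial>leb01)
      \<longlonglongrightarrow> (\<integral>x. (cmod (g x))\<^sup>2 \<partial>leb01)"
  proof (rule integral_dominated_convergence[where w = "\<lambda>x. (cmod (g x))\<^sup>2"])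
    show "AE x in leb01. (\<lambda>n. (cmod (g x))\<^sup>2 / (1 + cmod (g x) / real (Suc n))) \<longlonglongrightarrow> (cmod (g x))\<^sup>2"
    proof (rule AE_I2)
      fix x
      have "(\<lambda>n. cmod (g x) * (1 / real (Suc n))) \<longlonglongrightarrow> cmod (g x) * 0"
        by (intro tendsto_intros lim_1_over_n[THEN LIMSEQ_Suc])
      then have "(\<lambda>n. (cmod (g x))\<^sup>2 / (1 + cmod (g x) / real (Suc n))) \<longlonglongrightarrow> (cmod (g x))\<^sup>2 / (1 + 0)"
        by (intro tendsto_intros) auto
      then show "(\<lambda>n. (cmod (g x))\<^sup>2 / (1 + cmod (g x) / real (Suc n))) \<longlonglongrightarrow> (cmod (g x))\<^sup>2" by simp
    qed
    show "AE x in leb01. norm ((cmod (g x))\<^sup>2 / (1 + cmod (g x) / real (Suc n))) \<le> (cmod (g x))\<^sup>2" for n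
    proof (rule AE_I2)
      fix x
      show "norm ((cmod (g x))\<^sup>2 / (1 + cmod (g x) / real (Suc n))) \<le> (cmod (g x))\<^sup>2"
        using mult_left_mono[OF den[of "g x" n], of "(cmod (g x))\<^sup>2"] den_pos[of "g x" n]
        by (simp add: pos_divide_le_eq[OF den_pos] del: of_nat_Suc)
    qed
  qed (use L2_space_integrable_square[OF g] in \<open>auto simp del: of_nat_Suc\<close>)
  ultimately have "(L2_norm leb01 g)\<^sup>2 \<le> M * L2_norm leb01 g"
    unfolding L2_norm_square by (intro LIMSEQ_le_const2) auto
  then show ?thesis
    using M L2_norm_nonneg[of leb01 g] by (cases "L2_norm leb01 g = 0") (auto simp: power2_eq_square)
qed

subsection \<open>The duality argument for strong solutions\<close>

text \<open>\<open>weak_deriv\<close> is a choice; membership in \<open>H1_space\<close> guarantees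
  that there is something to choose, so the chosen function meets its specification.\<close>

lemma H2_weak_derivs:
  assumes "g \<in> H2_space"
  shows "g \<in> L2_space leb01" "weak_deriv g \<in> L2_space leb01" "is_weak_deriv g (weak_deriv g)"
    "weak_deriv (weak_deriv g) \<in> L2_space leb01" "is_weak_deriv (weak_deriv g) (weak_deriv (weak_deriv g))"
proof -
  have H1: "weak_deriv u \<in> L2_space leb01 \<and> is_weak_deriv u (weak_deriv u)" if "u \<in> H1_space" for u
    using that unfolding weak_deriv_def
    by (intro someI_ex[of "\<lambda>g'. g' \<in> L2_space leb01 \<and> is_weak_deriv u g'"]) (auto simp: H1_space_def)
  show "g \<in> L2_space leb01" "weak_deriv g \<in> L2_space leb01" "is_weak_deriv g (weak_deriv g)"
    "weak_deriv (weak_deriv g) \<in> L2_space leb01" "is_weak_deriv (weak_deriv g) (weak_deriv (weak_deriv g))"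
    using assms H1 by (auto simp: H2_space_def H1_space_def)
qed

text \<open>The first integration by parts moves a derivative from \<open>weak_deriv g\<close> onto
  a cosine and produces the traces; the second puts a sine against \<open>g\<close>, and
  \<open>n\<close> being an integer makes that sine vanish at both ends.\<close>

lemma H2_cosine_coefficient:
  assumes g: "g \<in> H2_space"
    and tr: "has_trace (weak_deriv g) 0 c0" "has_trace (weak_deriv g) 1 c1"
  shows "(\<integral>x. weak_deriv (weak_deriv g) x * of_real (cos (real n * pi * x)) \<partial>leb01)
    = of_real (cos (real n * pi)) * c1 - c0 - of_real ((real n * pi)\<^sup>2) * (\<integral>x. g x * of_real (cos (real n * pi * x)) \<partial>leb01)"
proof -
  define k where "k = real n * pi"
  define v where "v = weak_deriv g"
  define w where "w = weak_deriv v"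
  note H2 = H2_weak_derivs[OF g, folded v_def, folded w_def]
  have smooth: "smooth_fun (\<lambda>x. cos (k * x))" "smooth_fun (\<lambda>x. sin (k * x))"
    using smooth_fun_trig[of 1 k 0] smooth_fun_trig[of 0 k 1] by simp_all
  have deriv: "deriv (\<lambda>x. cos (k * x)) = (\<lambda>x. - k * sin (k * x))" "deriv (\<lambda>x. sin (k * x)) = (\<lambda>x. k * cos (k * x))"
    by (auto intro!: ext DERIV_imp_deriv derivative_eq_intros)
  have comm: "cos (k * x) *\<^sub>R u x = u x * complex_of_real (cos (k * x))" for u x
    by (simp add: scaleR_conv_of_real mult.commute)
  have "(\<integral>x. cos (k * x) *\<^sub>R w x \<partial>leb01)
      = cos (k * 1) *\<^sub>R c1 - cos (k * 0) *\<^sub>R c0 - (\<integral>x. deriv (\<lambda>x. cos (k * x)) x *\<^sub>R v x \<partial>leb01)"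
    by (rule weak_integral_by_parts[OF H2(2,4,5) smooth(1)]) (use tr in \<open>simp_all add: v_def\<close>)
  also have "(\<integral>x. deriv (\<lambda>x. cos (k * x)) x *\<^sub>R v x \<partial>leb01) = - k *\<^sub>R (\<integral>x. sin (k * x) *\<^sub>R v x \<partial>leb01)"
    unfolding deriv scaleR_scaleR[symmetric] by (rule integral_scaleR_right)
  also have "(\<integral>x. sin (k * x) *\<^sub>R v x \<partial>leb01) = - (\<integral>x. deriv (\<lambda>x. sin (k * x)) x *\<^sub>R g x \<partial>leb01)"
    by (rule weak_integral_by_parts_vanishing[OF H2(1,2,3) smooth(2)]) (simp_all add: k_def)
  also have "(\<integral>x. deriv (\<lambda>x. sin (k * x)) x *\<^sub>R g x \<partial>leb01) = k *\<^sub>R (\<integral>x. cos (k * x) *\<^sub>R g x \<partial>leb01)"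
    unfolding deriv scaleR_scaleR[symmetric] by (rule integral_scaleR_right)
  finally show ?thesis
    unfolding comm by (simp add: scaleR_conv_of_real power2_eq_square w_def v_def k_def mult.assoc)
qed

text \<open>Pairing with a fixed \<open>e\<close> is a bounded functional on L2, so it carries the
  L2 derivative over to a scalar one: the error of the scalar difference quotient is the pairing of
  \<open>e\<close> with \<open>q s\<close>, and Cauchy-Schwarz applies.\<close>

lemma has_L2_time_deriv_coefficient:
  assumes der: "has_L2_time_deriv T \<phi> \<phi>'" and \<phi>: "\<And>s. s \<in> {0..T} \<Longrightarrow> \<phi> s \<in> L2_space leb01"
    and e: "e \<in> L2_space leb01" and t: "t \<in> {0..T}"
  shows "((\<lambda>s. \<integral>x. \<phi> s x * e x \<partial>leb01) has_vector_derivative (\<integral>x. \<phi>' t x * e x \<partial>leb01)) (at t within {0..T})"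
proof -
  define q where "q s x = (\<phi> s x - \<phi> t x) /\<^sub>R (s - t) - \<phi>' t x" for s x
  define c where "c s = (\<integral>x. \<phi> s x * e x \<partial>leb01)" for s
  define c' where "c' = (\<integral>x. \<phi>' t x * e x \<partial>leb01)"
  have \<phi>': "\<phi>' t \<in> L2_space leb01" and lim: "((\<lambda>s. L2_norm leb01 (q s)) \<longlongrightarrow> 0) (at t within {0..T})"
    using der t by (auto simp: has_L2_time_deriv_def q_def[abs_def])
  have bound: "norm ((c s - c t) - (s - t) *\<^sub>R c') / norm (s - t) \<le> L2_norm leb01 (q s) * L2_norm leb01 e"
    if "s \<in> {0..T}" "s \<noteq> t" for s
  proof -
    have q: "q s \<in> L2_space leb01"
      using L2_space_diff[OF L2_space_cmult[OF L2_space_diff[OF \<phi>[OF that(1)] \<phi>[OF t]], of "of_real (inverse (s - t))"] \<phi>']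
      by (simp add: q_def[abs_def] scaleR_conv_of_real)
    have "(\<integral>x. q s x * e x \<partial>leb01) = (\<integral>x. of_real (inverse (s - t)) * (\<phi> s x * e x) -
        of_real (inverse (s - t)) * (\<phi> t x * e x) - \<phi>' t x * e x \<partial>leb01)"
      by (intro Bochner_Integration.integral_cong refl) (simp add: q_def scaleR_conv_of_real algebra_simps)
    also have "\<dots> = of_real (inverse (s - t)) * c s - of_real (inverse (s - t)) * c t - c'"
      using L2_space_mult_integrable[OF \<phi>[OF that(1)] e] L2_space_mult_integrable[OF \<phi>[OF t] e]
        L2_space_mult_integrable[OF \<phi>' e]
      by (simp add: c_def c'_def)
    also have "\<dots> = ((c s - c t) - (s - t) *\<^sub>R c') / of_real (s - t)"
    proof -
      define d where "d = complex_of_real (s - t)"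
      have "d \<noteq> 0" using that by (simp add: d_def)
      then show ?thesis
        unfolding scaleR_conv_of_real of_real_inverse d_def[symmetric] by (simp add: divide_simps)
    qed
    finally have "norm ((c s - c t) - (s - t) *\<^sub>R c') / norm (s - t) = norm (\<integral>x. q s x * e x \<partial>leb01)"
      by (simp only: norm_divide norm_of_real real_norm_def)
    with L2_Cauchy_Schwarz_integral[OF q e] show ?thesis by simp
  qed
  have "((\<lambda>s. norm ((c s - c t) - (s - t) *\<^sub>R c') / norm (s - t)) \<longlongrightarrow> 0) (at t within {0..T})"
  proof (rule Lim_null_comparison)
    show "\<forall>\<^sub>F s in at t within {0..T}. norm (norm ((c s - c t) - (s - t) *\<^sub>R c') / norm (s - t))
        \<le> L2_norm leb01 (q s) * L2_norm leb01 e"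
      using bound by (auto simp: eventually_at_filter)
    show "((\<lambda>s. L2_norm leb01 (q s) * L2_norm leb01 e) \<longlongrightarrow> 0) (at t within {0..T})"
      using tendsto_mult_right[OF lim, of "L2_norm leb01 e"] by simp
  qed
  then show ?thesis
    unfolding has_vector_derivative_def has_derivative_iff_norm
    by (simp add: c_def c'_def bounded_linear_scaleR_left)
qed

text \<open>The data are Lebesgue integrable on (0, \<open>T\<close>), whereas the fundamental
  theorem yields gauge integrals up to the time \<open>t\<close>; this passes from one to the
  other.\<close>

lemma norm_integral_initial_le:
  fixes u :: "real \<Rightarrow> 'a::euclidean_space"
  assumes u: "integrable (lebesgue_on {0<..<T}) u" and "t \<le> T"
  shows "u integrable_on {0<..<t}"
    and "norm (integral {0<..<t} u) \<le> (\<integral>s. norm (u s) \<partial>lebesgue_on {0<..<T})"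
proof -
  have sub: "{0<..<t} \<subseteq> {0<..<T}" using assms(2) by auto
  have abs: "u absolutely_integrable_on {0<..<T}"
    using u by (simp add: set_integrable_def integrable_restrict_space)
  then have abs_t: "u absolutely_integrable_on {0<..<t}"
    by (rule set_integrable_subset) (use sub in auto)
  then show int: "u integrable_on {0<..<t}" by (rule set_lebesgue_integral_eq_integral)
  have n: "(\<lambda>s. norm (u s)) integrable_on {0<..<t}" "(\<lambda>s. norm (u s)) integrable_on {0<..<T}"
    using abs abs_t by (auto simp: absolutely_integrable_on_def)
  have "norm (integral {0<..<t} u) \<le> integral {0<..<t} (\<lambda>s. norm (u s))"
    by (rule Henstock_Kurzweil_Integration.integral_norm_bound_integral[OF int n(1)]) simp
  also have "\<dots> \<le> integral {0<..<T} (\<lambda>s. norm (u s))"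
    by (rule integral_subset_le[OF sub n]) simp
  also have "\<dots> = (\<integral>s. norm (u s) \<partial>lebesgue_on {0<..<T})"
    using u by (intro lebesgue_integral_eq_integral[symmetric]) auto
  finally show "norm (integral {0<..<t} u) \<le> (\<integral>s. norm (u s) \<partial>lebesgue_on {0<..<T})" .
qed

text \<open>Only the moduli of \<open>b\<close> are tied to \<open>a\<close>, so that both ends are
  covered: at 0 the coefficients are \<open>a\<close>, at 1 they carry the signs cos (n
  \<pi>).\<close>

lemma boundary_term_bound:
  fixes a b :: "nat \<Rightarrow> complex" and N :: nat and r :: real
  assumes h: "h \<in> L2_space (lebesgue_on {0<..<T})" and T: "0 \<le> T" "T \<le> 1" and "t \<le> T"
    and b: "\<And>n. cmod (b n) = cmod (a n)"
  defines "p \<equiv> \<lambda>s. \<Sum>n<N. b n * cis ((real n * pi)\<^sup>2 * (s - r))"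
  shows "(\<lambda>s. h s * p s) integrable_on {0<..<t}"
    and "cmod (integral {0<..<t} (\<lambda>s. h s * p s))
      \<le> 2 * L2_norm (lebesgue_on {0<..<T}) h * L2_norm leb01 (cosine_sum a N)"
proof -
  have p: "p \<in> L2_space (lebesgue_on {0<..<T})"
    unfolding p_def by (rule exponential_sum_bound(1)[OF T])
  have int: "integrable (lebesgue_on {0<..<T}) (\<lambda>s. h s * p s)"
    using h p by (rule L2_space_mult_integrable)
  show "(\<lambda>s. h s * p s) integrable_on {0<..<t}"
    by (rule norm_integral_initial_le(1)[OF int \<open>t \<le> T\<close>])
  have "4 / pi * (\<Sum>n<N. (cmod (b n))\<^sup>2) \<le> 2 * (\<Sum>n<N. (cmod (b n))\<^sup>2)"
    using pi_ge_two by (intro mult_right_mono sum_nonneg) (auto simp: field_simps)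
  \<comment> \<open>Each \<open>cosine_weight n\<close> is at least 1/2, which costs a second factor
    2.\<close>
  also have "\<dots> \<le> 4 * (\<Sum>n<N. (cmod (a n))\<^sup>2 * cosine_weight n)"
    unfolding sum_distrib_left by (intro sum_mono) (auto simp: b cosine_weight_def)
  also have "\<dots> = (2 * L2_norm leb01 (cosine_sum a N))\<^sup>2"
    by (simp add: L2_norm_cosine_sum power_mult_distrib)
  finally have "sqrt (4 / pi * (\<Sum>n<N. (cmod (b n))\<^sup>2)) \<le> 2 * L2_norm leb01 (cosine_sum a N)"
    by (intro real_le_lsqrt) (auto intro!: mult_nonneg_nonneg sum_nonneg)
  then have pn: "L2_norm (lebesgue_on {0<..<T}) p \<le> 2 * L2_norm leb01 (cosine_sum a N)"
    using exponential_sum_bound(2)[OF T, where N = N and b = b and t = r] unfolding p_def by linarith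
  have "cmod (integral {0<..<t} (\<lambda>s. h s * p s)) \<le> (\<integral>s. cmod (h s * p s) \<partial>lebesgue_on {0<..<T})"
    by (rule norm_integral_initial_le(2)[OF int \<open>t \<le> T\<close>])
  also have "\<dots> \<le> L2_norm (lebesgue_on {0<..<T}) h * L2_norm (lebesgue_on {0<..<T}) p"
    by (rule L2_Cauchy_Schwarz[OF h p])
  also have "\<dots> \<le> L2_norm (lebesgue_on {0<..<T}) h * (2 * L2_norm leb01 (cosine_sum a N))"
    by (intro mult_left_mono pn) simp
  finally show "cmod (integral {0<..<t} (\<lambda>s. h s * p s))
      \<le> 2 * L2_norm (lebesgue_on {0<..<T}) h * L2_norm leb01 (cosine_sum a N)"
    by (simp add: mult_ac)
qed

text \<open>The bound on the essential supremum asks for measurability in time, which follows from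
  continuity of the norm by the reverse triangle inequality.\<close>

lemma C0_L2_norm_measurable:
  assumes "u \<in> C0_L2 T"
  shows "(\<lambda>t. L2_norm leb01 (u t)) \<in> borel_measurable (lebesgue_on {0<..<T})"
proof -
  have u: "\<And>t. t \<in> {0..T} \<Longrightarrow> u t \<in> L2_space leb01"
    "\<And>s. s \<in> {0..T} \<Longrightarrow> ((\<lambda>t. L2_norm leb01 (\<lambda>x. u t x - u s x)) \<longlongrightarrow> 0) (at s within {0..T})"
    using assms by (auto simp: C0_space_def)
  have "((\<lambda>t. L2_norm leb01 (u t)) \<longlongrightarrow> L2_norm leb01 (u s)) (at s within {0..T})" if "s \<in> {0..T}" for s
  proof -
    have "((\<lambda>t. L2_norm leb01 (u t) - L2_norm leb01 (u s)) \<longlongrightarrow> 0) (at s within {0..T})"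
    proof (rule Lim_null_comparison[OF _ u(2)[OF that]])
      show "\<forall>\<^sub>F t in at s within {0..T}. norm (L2_norm leb01 (u t) - L2_norm leb01 (u s))
          \<le> L2_norm leb01 (\<lambda>x. u t x - u s x)"
        using L2_norm_diff_abs_le[OF u(1) u(1)[OF that]] by (auto simp: eventually_at_filter)
    qed
    then show ?thesis by (rule LIM_zero_cancel)
  qed
  then have "continuous_on {0..T} (\<lambda>t. L2_norm leb01 (u t))"
    by (simp add: continuous_on_def)
  then show ?thesis by (rule borel_measurable_lebesgue_on_continuous)
qed

section \<open>The pairing with the adjoint solution and the final estimate\<close>

lemma strong_solution_pairing_bound:
  assumes T: "0 < T" "T \<le> 1"
    and h: "h0 \<in> L2_space (lebesgue_on {0<..<T})" "h1 \<in> L2_space (lebesgue_on {0<..<T})"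
    and f: "f \<in> L1_L2 T" and \<phi>: "\<phi> \<in> C0_H2 T \<inter> C1_L2 T"
    and sol: "strong_solution T h0 h1 f \<phi>" and init: "AE x in leb01. \<phi> 0 x = 0"
    and t: "t \<in> {0<..<T}"
  shows "cmod (\<integral>x. \<phi> t x * cosine_sum a N x \<partial>leb01)
    \<le> 2 * (L2_norm (lebesgue_on {0<..<T}) h0 + L2_norm (lebesgue_on {0<..<T}) h1 + L1_L2_norm T f)
        * L2_norm leb01 (cosine_sum a N)"
proof -
  have H2: "\<phi> s \<in> H2_space" if "s \<in> {0..T}" for s
    using \<phi> that by (auto simp: C0_space_def)
  note L2 = H2_weak_derivs[OF H2]
  obtain \<phi>' where der: "has_L2_time_deriv T \<phi> \<phi>'"
    and eq: "\<And>s. s \<in> {0..T} \<Longrightarrow> AE x in leb01. \<i> * \<phi>' s x = - weak_deriv (weak_deriv (\<phi> s)) x + f s x"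
    and tr0: "\<And>s. s \<in> {0..T} \<Longrightarrow> has_trace (weak_deriv (\<phi> s)) 0 (h0 s)"
    and tr1: "\<And>s. s \<in> {0..T} \<Longrightarrow> has_trace (weak_deriv (\<phi> s)) 1 (h1 s)"
    using sol unfolding strong_solution_def by blast
  have \<phi>'_L2: "\<phi>' s \<in> L2_space leb01" if "s \<in> {0..T}" for s
    using der that by (simp add: has_L2_time_deriv_def)
  have f_L2: "f s \<in> L2_space leb01" if "s \<in> {0<..<T}" for s
    using f that by (simp add: L1_L2_def)
  have f_int: "integrable (lebesgue_on {0<..<T}) (\<lambda>s. L2_norm leb01 (f s))"
    using f by (simp add: L1_L2_def)
  define e where "e n x = complex_of_real (cos (real n * pi * x))" for n x
  have e: "e n \<in> L2_space leb01" for n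
    unfolding e_def[abs_def] by (intro L2_space_leb01_continuous continuous_intros)
  \<comment> \<open>The phases of the adjoint solution, equal to 1 at the final time
    \<open>t\<close>. \<open>p0\<close> and \<open>p1\<close> below are its values at the two
    endpoints, and \<open>U\<close> is its pairing with \<open>\<phi> s\<close>.\<close>
  define \<mu> where "\<mu> n s = cis ((real n * pi)\<^sup>2 * (s - t))" for n s
  define c where "c n s = (\<integral>x. \<phi> s x * e n x \<partial>leb01)" for n s
  define c' where "c' n s = (\<integral>x. \<phi>' s x * e n x \<partial>leb01)" for n s
  define p0 where "p0 s = (\<Sum>n<N. a n * \<mu> n s)" for s
  define p1 where "p1 s = (\<Sum>n<N. (a n * of_real (cos (real n * pi))) * \<mu> n s)" for s
  define F where "F s = (\<integral>x. f s x * cosine_sum (\<lambda>n. a n * \<mu> n s) N x \<partial>leb01)" for s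
  define U where "U s = (\<Sum>n<N. a n * (\<mu> n s * c n s))" for s
  define U' where "U' s = (\<Sum>n<N. a n * (\<mu> n s * c' n s + \<i> * of_real ((real n * pi)\<^sup>2) * \<mu> n s * c n s))" for s
  define P where "P = L2_norm leb01 (cosine_sum a N)"

  have U_deriv: "(U has_vector_derivative U' s) (at s within {0..T})" if "s \<in> {0..T}" for s
  proof -
    have "(c n has_vector_derivative c' n s) (at s within {0..T})" for n
      unfolding c_def c'_def by (rule has_L2_time_deriv_coefficient[OF der L2(1) e that])
    moreover have "(\<mu> n has_vector_derivative \<i> * of_real ((real n * pi)\<^sup>2) * \<mu> n s) (at s within {0..T})" for n
      unfolding \<mu>_def by (rule has_vector_derivative_cis_affine)
    ultimately show ?thesis
      unfolding U_def U'_def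
      by (intro has_vector_derivative_sum has_vector_derivative_mult_right has_vector_derivative_mult)
  qed

  have pairing: "(\<integral>x. u x * cosine_sum b N x \<partial>leb01) = (\<Sum>n<N. b n * (\<integral>x. u x * e n x \<partial>leb01))"
    if "u \<in> L2_space leb01" for u b
  proof -
    have "(\<integral>x. u x * cosine_sum b N x \<partial>leb01) = (\<integral>x. (\<Sum>n<N. b n * (u x * e n x)) \<partial>leb01)"
      by (intro Bochner_Integration.integral_cong refl)
         (simp add: cosine_sum_def e_def sum_distrib_left mult_ac)
    also have "\<dots> = (\<Sum>n<N. b n * (\<integral>x. u x * e n x \<partial>leb01))"
      using L2_space_mult_integrable[OF that e] by simp
    finally show ?thesis .
  qed

  have U'_eq: "U' s = \<i> * (h1 s * p1 s - h0 s * p0 s - F s)" if "s \<in> {0<..<T}" for s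
  proof -
    from that have s: "s \<in> {0..T}" by auto
    define w where "w = weak_deriv (weak_deriv (\<phi> s))"
    have w: "w \<in> L2_space leb01" unfolding w_def by (rule L2(4)[OF s])
    have c'_eq: "c' n s = \<i> * (of_real (cos (real n * pi)) * h1 s - h0 s
        - of_real ((real n * pi)\<^sup>2) * c n s - (\<integral>x. f s x * e n x \<partial>leb01))" for n
    proof -
      have "\<i> * c' n s = (\<integral>x. \<i> * \<phi>' s x * e n x \<partial>leb01)"
        unfolding c'_def by (simp add: mult.assoc)
      also have "\<dots> = (\<integral>x. f s x * e n x - w x * e n x \<partial>leb01)"
      proof (rule integral_cong_AE)
        show "AE x in leb01. \<i> * \<phi>' s x * e n x = f s x * e n x - w x * e n x"
          using eq[OF s]
        proof eventually_elim
          case (elim x)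
          show ?case unfolding elim w_def by (simp add: algebra_simps)
        qed
      qed (use w \<phi>'_L2[OF s] f_L2[OF that] e in \<open>auto dest!: L2_space_measurable\<close>)
      also have "\<dots> = (\<integral>x. f s x * e n x \<partial>leb01) - (\<integral>x. w x * e n x \<partial>leb01)"
        using L2_space_mult_integrable[OF f_L2[OF that] e] L2_space_mult_integrable[OF w e]
        by (rule Bochner_Integration.integral_diff)
      also have "(\<integral>x. w x * e n x \<partial>leb01) = of_real (cos (real n * pi)) * h1 s - h0 s - of_real ((real n * pi)\<^sup>2) * c n s"
        unfolding w_def e_def c_def by (rule H2_cosine_coefficient[OF H2[OF s] tr0[OF s] tr1[OF s]])
      finally have "\<i> * c' n s = (\<integral>x. f s x * e n x \<partial>leb01)
          - (of_real (cos (real n * pi)) * h1 s - h0 s - of_real ((real n * pi)\<^sup>2) * c n s)" .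
      then have "- (\<i> * (\<i> * c' n s)) = - (\<i> * ((\<integral>x. f s x * e n x \<partial>leb01)
          - (of_real (cos (real n * pi)) * h1 s - h0 s - of_real ((real n * pi)\<^sup>2) * c n s)))"
        by (simp only:)
      then show ?thesis by (simp add: algebra_simps)
    qed
    \<comment> \<open>The frequency term of \<open>c' n s\<close> cancels against the derivative of
      \<open>\<mu> n\<close>: this is where the adjoint equation is used.\<close>
    have "U' s = (\<Sum>n<N. \<i> * (h1 s * ((a n * of_real (cos (real n * pi))) * \<mu> n s)
        - h0 s * (a n * \<mu> n s) - (a n * \<mu> n s) * (\<integral>x. f s x * e n x \<partial>leb01)))"
      unfolding U'_def c'_eq by (intro sum.cong refl) (simp add: algebra_simps)
    also have "\<dots> = \<i> * (h1 s * p1 s - h0 s * p0 s - (\<Sum>n<N. (a n * \<mu> n s) * (\<integral>x. f s x * e n x \<partial>leb01)))"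
      by (simp only: p0_def p1_def sum_distrib_left sum_subtractf right_diff_distrib)
    finally show ?thesis
      unfolding F_def pairing[OF f_L2[OF that]] .
  qed

  have t0: "0 \<le> t" "t \<le> T" "t \<in> {0..T}" using t by auto
  \<comment> \<open>The gauge integral recovers \<open>U\<close> from its derivative in the interior
    and continuity up to the ends; integrability of \<open>U'\<close> is part of the
    conclusion.\<close>
  have "(U' has_integral U t - U 0) {0..t}"
  proof (rule fundamental_theorem_of_calculus_interior)
    have "continuous_on {0..T} U"
      using U_deriv by (intro continuous_on_vector_derivative)
    then show "continuous_on {0..t} U"
      by (rule continuous_on_subset) (use t0 in auto)
    show "(U has_vector_derivative U' s) (at s)" if "s \<in> {0<..<t}" for s
    proof -
      have s: "s \<in> {0..T}" "s \<in> interior {0..T}" using that t0 by auto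
      show ?thesis using U_deriv[OF s(1)] unfolding at_within_interior[OF s(2)] .
    qed
  qed (use t0 in simp)
  then have U'_int: "(U' has_integral U t - U 0) {0<..<t}"
    by (simp add: has_integral_Icc_iff_Ioo)
  have "c n 0 = 0" for n
  proof -
    have "c n 0 = (\<integral>x. 0 \<partial>leb01)"
      unfolding c_def
      by (rule integral_cong_AE)
         (use init L2(1)[of 0] e T in \<open>auto dest!: L2_space_measurable elim: eventually_mono\<close>)
    then show ?thesis by simp
  qed
  then have "U 0 = 0" by (simp add: U_def)
  have U_t: "U t = (\<integral>x. \<phi> t x * cosine_sum a N x \<partial>leb01)"
    unfolding pairing[OF L2(1)[OF t0(3)]] U_def by (simp add: c_def \<mu>_def)

  have b0: "(\<lambda>s. h0 s * p0 s) integrable_on {0<..<t}"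
    "cmod (integral {0<..<t} (\<lambda>s. h0 s * p0 s)) \<le> 2 * L2_norm (lebesgue_on {0<..<T}) h0 * P"
    unfolding p0_def \<mu>_def P_def
    using boundary_term_bound[OF h(1) _ T(2) t0(2), where b = a and a = a and N = N and r = t] T by auto
  have b1: "(\<lambda>s. h1 s * p1 s) integrable_on {0<..<t}"
    "cmod (integral {0<..<t} (\<lambda>s. h1 s * p1 s)) \<le> 2 * L2_norm (lebesgue_on {0<..<T}) h1 * P"
    unfolding p1_def \<mu>_def P_def
    using boundary_term_bound[OF h(2) _ T(2) t0(2), where b = "\<lambda>n. a n * of_real (cos (real n * pi))"
      and a = a and N = N and r = t] T
    by (auto simp: norm_mult norm_power)

  have U'_integrable: "(\<lambda>s. \<i> * U' s) integrable_on {0<..<t}"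
    using has_integral_mult_right[OF U'_int, of \<i>] by (auto simp: integrable_on_def)
  \<comment> \<open>Solving the formula for \<open>U'\<close> for \<open>F\<close> expresses it
    through functions already known to be integrable, so \<open>F\<close> inherits integrability in
    time.\<close>
  have "(\<lambda>s. \<i> * U' s + (h1 s * p1 s - h0 s * p0 s)) integrable_on {0<..<t}"
    by (intro integrable_add integrable_diff U'_integrable b0 b1)
  then have F_int: "F integrable_on {0<..<t}"
  proof (rule integrable_eq)
    fix s assume "s \<in> {0<..<t}"
    with t0 have "U' s = \<i> * (h1 s * p1 s - h0 s * p0 s - F s)" by (intro U'_eq) auto
    then show "\<i> * U' s + (h1 s * p1 s - h0 s * p0 s) = F s"
      by (simp only:) (simp add: algebra_simps)
  qed
  have F_le: "cmod (F s) \<le> L2_norm leb01 (f s) * P" if "s \<in> {0<..<t}" for s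
  proof -
    have "(L2_norm leb01 (cosine_sum (\<lambda>n. a n * \<mu> n s) N))\<^sup>2 = P\<^sup>2"
      unfolding P_def L2_norm_cosine_sum by (simp add: norm_mult \<mu>_def)
    then have "L2_norm leb01 (cosine_sum (\<lambda>n. a n * \<mu> n s) N) = P"
      by (simp add: P_def power2_eq_iff_nonneg)
    moreover have "cosine_sum b N \<in> L2_space leb01" for b
      by (intro L2_space_leb01_continuous continuous_on_cosine_sum)
    ultimately show ?thesis
      unfolding F_def using L2_Cauchy_Schwarz_integral[OF f_L2, of s] that t0 by auto
  qed
  have fP_int: "integrable (lebesgue_on {0<..<T}) (\<lambda>s. L2_norm leb01 (f s) * P)"
    using f_int by simp
  have "cmod (integral {0<..<t} F) \<le> integral {0<..<t} (\<lambda>s. L2_norm leb01 (f s) * P)"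
    by (rule Henstock_Kurzweil_Integration.integral_norm_bound_integral
        [OF F_int norm_integral_initial_le(1)[OF fP_int t0(2)] F_le])
  also have "\<dots> \<le> integral {0<..<T} (\<lambda>s. L2_norm leb01 (f s) * P)"
    using t0 norm_integral_initial_le(1)[OF fP_int]
    by (intro integral_subset_le) (auto simp: P_def)
  also have "\<dots> = (\<integral>s. L2_norm leb01 (f s) * P \<partial>lebesgue_on {0<..<T})"
    by (rule lebesgue_integral_eq_integral[symmetric]) (use f_int in auto)
  also have "\<dots> = L1_L2_norm T f * P"
    by (simp add: L1_L2_norm_def)
  finally have bF: "cmod (integral {0<..<t} F) \<le> L1_L2_norm T f * P" .

  have "integral {0<..<t} U' = integral {0<..<t} (\<lambda>s. \<i> * (h1 s * p1 s - h0 s * p0 s - F s))"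
    using U'_eq t0 by (intro Henstock_Kurzweil_Integration.integral_cong) auto
  also have "\<dots> = \<i> * (integral {0<..<t} (\<lambda>s. h1 s * p1 s) - integral {0<..<t} (\<lambda>s. h0 s * p0 s) - integral {0<..<t} F)"
    by (simp add: integral_mult_right Henstock_Kurzweil_Integration.integral_diff integrable_diff b0 b1 F_int)
  finally have "U t = \<i> * (integral {0<..<t} (\<lambda>s. h1 s * p1 s) - integral {0<..<t} (\<lambda>s. h0 s * p0 s) - integral {0<..<t} F)"
    using U'_int \<open>U 0 = 0\<close> by (simp add: integral_unique)
  then have "cmod (U t) = cmod (integral {0<..<t} (\<lambda>s. h1 s * p1 s) - integral {0<..<t} (\<lambda>s. h0 s * p0 s) - integral {0<..<t} F)"
    by (simp add: norm_mult)
  also have "\<dots> \<le> cmod (integral {0<..<t} (\<lambda>s. h1 s * p1 s)) + cmod (integral {0<..<t} (\<lambda>s. h0 s * p0 s)) + cmod (integral {0<..<t} F)"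
    by (meson add_mono norm_triangle_ineq4 order_refl order_trans)
  \<comment> \<open>The forcing term satisfies the bound with constant 1; it is doubled to share the
    factor of the boundary terms, which is harmless because \<open>bF\<close> shows its bound to be
    nonnegative.\<close>
  also have "\<dots> \<le> 2 * L2_norm (lebesgue_on {0<..<T}) h1 * P + 2 * L2_norm (lebesgue_on {0<..<T}) h0 * P
      + 2 * (L1_L2_norm T f * P)"
    using b0(2) b1(2) bF by (smt (verit) norm_ge_zero)
  finally show ?thesis
    unfolding U_t P_def by (simp add: algebra_simps)
qed

theorem proposition6p2:
  "\<exists>C::real. C > 0 \<and>
     (\<forall>(T::real) (h0::real \<Rightarrow> complex) (h1::real \<Rightarrow> complex)
        (f::real \<Rightarrow> real \<Rightarrow> complex) (\<phi>::real \<Rightarrow> real \<Rightarrow> complex).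
        0 < T \<longrightarrow> T \<le> 1 \<longrightarrow>
        h0 \<in> L2_space (lebesgue_on {0<..<T}) \<longrightarrow>
        h1 \<in> L2_space (lebesgue_on {0<..<T}) \<longrightarrow>
        f \<in> L1_L2 T \<longrightarrow>
        \<phi> \<in> C0_H2 T \<inter> C1_L2 T \<longrightarrow>
        strong_solution T h0 h1 f \<phi> \<longrightarrow>
        (AE x in leb01. \<phi> 0 x = 0) \<longrightarrow>
        Linf_L2_norm T \<phi> \<le>
          ereal (C * (L2_norm (lebesgue_on {0<..<T}) h0 + L2_norm (lebesgue_on {0<..<T}) h1
                      + L1_L2_norm T f)))"
proof (intro exI[of _ 2] conjI allI impI)
  fix T :: real and h0 h1 :: "real \<Rightarrow> complex" and f \<phi> :: "real \<Rightarrow> real \<Rightarrow> complex"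
  assume *: "0 < T" "T \<le> 1" "h0 \<in> L2_space (lebesgue_on {0<..<T})" "h1 \<in> L2_space (lebesgue_on {0<..<T})"
    "f \<in> L1_L2 T" "\<phi> \<in> C0_H2 T \<inter> C1_L2 T" "strong_solution T h0 h1 f \<phi>" "AE x in leb01. \<phi> 0 x = 0"
  \<comment> \<open>The factor 2 is the constant of the pairing estimate. Since that estimate holds
    for all coefficients at each time, duality bounds the norm at every \<open>t\<close> in (0,
    \<open>T\<close>), hence also the essential supremum.\<close>
  define M where "M = 2 * (L2_norm (lebesgue_on {0<..<T}) h0 + L2_norm (lebesgue_on {0<..<T}) h1 + L1_L2_norm T f)"
  have "0 \<le> M" by (auto simp: M_def L1_L2_norm_def intro!: add_nonneg_nonneg Bochner_Integration.integral_nonneg)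
  have C0: "\<phi> \<in> C0_L2 T" using *(6) by (simp add: C1_L2_def)
  have "L2_norm leb01 (\<phi> t) \<le> M" if "t \<in> {0<..<T}" for t
    using C0 that strong_solution_pairing_bound[OF * that, folded M_def] \<open>0 \<le> M\<close>
    by (intro L2_norm_le_by_cosine_duality) (auto simp: C0_space_def)
  then show "Linf_L2_norm T \<phi> \<le> ereal (2 * (L2_norm (lebesgue_on {0<..<T}) h0
      + L2_norm (lebesgue_on {0<..<T}) h1 + L1_L2_norm T f))"
    unfolding Linf_L2_norm_def M_def[symmetric]
    by (intro esssup_I borel_measurable_ereal C0_L2_norm_measurable C0 AE_I2) auto
qed simp

end
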